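(* Let $A\in\mathbb{R}^{n\times n}$, $B\in\mathbb{R}^{n\times m}$, $C\in\mathbb{R}^{m\times n}$, $D\in\mathbb{R}^{m\times m}$ be such that the state-space system $\dot x(t)=Ax(t)+Bu(t)$, $y(t)=Cx(t)+Du(t)$ is minimal, and let $$P=\begin{bmatrix} A & B\\ C & D\end{bmatrix}\in\mathbb{R}^{(n+m)\times(n+m)}$$ be its system matrix. Let $r$, $t_1,\dots,t_r$, $W$, $Z$ and the Khatri-Rao product $Z\star W$ be associated with $P$ as defined in the context. If the system represented by $P$ is symmetrizable, then $$\operatorname{Rank}(Z\star W)< t_1^2+\dots+t_r^2 .$$
   Context: Symmetrizability. The transfer function of the state-space system is $G(s)=C(sI-A)^{-1}B+D$. The system is minimal if $(A,B)$ is controllable and $(A,C)$ is observable. A signature matrix is a diagonal matrix whose diagonal elements are each $+1$ or $-1$. A linear system with $m\times m$ transfer function $H(s)$ is symmetric if there is a signature matrix $\Sigma_e\in\mathbb{R}^{m\times m}$ such that $\Sigma_e H^\top(s)=H(s)\Sigma_e$. A linear system with $m\times m$ transfer function $G(s)$ is symmetrizable if there exists a constant invertible matrix $K\in\mathbb{R}^{m\times m}$ such that $H(s)=K^{-1}G(s)K$ is symmetric. The matrices $W$, $Z$. Let $P$ have $r:=p+q$ distinct real eigenvalues and complex-conjugate eigenvalue pairs, counted regardless of multiplicities: $p$ distinct real eigenvalues $\lambda_1,\dots,\lambda_p$ and $q$ distinct pairs of (non-real) complex-conjugate eigenvalues $(\lambda_{p+1},\bar\lambda_{p+1}),\dots,(\lambda_{p+q},\bar\lambda_{p+q})$.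 With $\mathrm{mul}(\lambda)$ denoting the algebraic multiplicity of $\lambda$ as an eigenvalue of $P$, put $t_j:=\mathrm{mul}(\lambda_j)$ if $\lambda_j\in\mathbb{R}$ and $t_j:=2\,\mathrm{mul}(\lambda_j)$ if $\lambda_j\notin\mathbb{R}$, for $j=1,\dots,r$. Let $V\in\mathbb{R}^{(n+m)\times(n+m)}$ be an invertible matrix bringing $P$ to real Jordan normal form with blocks ordered as $J=V^{-1}PV=\bigoplus_{j=1}^{r}\hat J_j$ (direct sum of matrices), where $\hat J_j\in\mathbb{R}^{t_j\times t_j}$ contains all the real Jordan blocks with eigenvalue $\lambda_j$ if $\lambda_j\in\mathbb{R}$, and all the real Jordan blocks with eigenvalues $\lambda_j$ and $\bar\lambda_j$ otherwise. Partition $$V=\begin{bmatrix} W\\ Z\end{bmatrix},\qquad W\in\mathbb{R}^{n\times(n+m)},\quad Z\in\mathbb{R}^{m\times(n+m)},$$ and partition column-wise $W=[W_1\; W_2\;\dots\; W_r]$ with $W_j\in\mathbb{R}^{n\times t_j}$ and $Z=[Z_1\; Z_2\;\dots\; Z_r]$ with $Z_j\in\mathbb{R}^{m\times t_j}$. Khatri-Rao product. With respect to these partitions, the (column-wise) Khatri-Rao product is $$Z\star W:=[\,Z_1\otimes W_1\;\; Z_2\otimes W_2\;\;\dots\;\; Z_r\otimes W_r\,],$$ where $\otimes$ is the Kronecker product. *)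

theory Defs
  imports
    Jordan_Normal_Form.DL_Rank
    Jordan_Normal_Form.Spectral_Radius
    Jordan_Normal_Form.Gauss_Jordan_Elimination
begin

abbreviation mat_rank :: "'a :: field mat \<Rightarrow> nat" where
  "mat_rank M \<equiv> vec_space.rank (dim_row M) M"

(* Meaningful for invertible M only. *)
abbreviation mat_inv :: "'a :: field mat \<Rightarrow> 'a mat" where
  "mat_inv M \<equiv> the (mat_inverse M)"

abbreviation cmat :: "real mat \<Rightarrow> complex mat" where
  "cmat M \<equiv> map_mat complex_of_real M"

(* [B, A B, ..., A^(n-1) B] for A of size n x n and B of size n x m *)
definition controllability_mat :: "'a :: field mat \<Rightarrow> 'a mat \<Rightarrow> 'a mat" where
  "controllability_mat A B =
     mat (dim_row A) (dim_row A * dim_col B)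
       (\<lambda>(i, j). (A ^\<^sub>m (j div dim_col B) * B) $$ (i, j mod dim_col B))"

(* C, C A, ..., C A^(n-1) stacked on top of each other *)
definition observability_mat :: "'a :: field mat \<Rightarrow> 'a mat \<Rightarrow> 'a mat" where
  "observability_mat A C =
     mat (dim_row A * dim_row C) (dim_row A)
       (\<lambda>(i, j). (C * A ^\<^sub>m (i div dim_row C)) $$ (i mod dim_row C, j))"

definition controllable :: "'a :: field mat \<Rightarrow> 'a mat \<Rightarrow> bool" where
  "controllable A B \<longleftrightarrow> mat_rank (controllability_mat A B) = dim_row A"

definition observable :: "'a :: field mat \<Rightarrow> 'a mat \<Rightarrow> bool" where
  "observable A C \<longleftrightarrow> mat_rank (observability_mat A C) = dim_row A"

definition minimal_system :: "'a :: field mat \<Rightarrow> 'a mat \<Rightarrow> 'a mat \<Rightarrow> bool" where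
  "minimal_system A B C \<longleftrightarrow> controllable A B \<and> observable A C"

(* The transfer function is used only at points s outside the spectrum of A. *)
definition transfer_function ::
  "real mat \<Rightarrow> real mat \<Rightarrow> real mat \<Rightarrow> real mat \<Rightarrow> complex \<Rightarrow> complex mat" where
  "transfer_function A B C D s =
     cmat C * mat_inv (s \<cdot>\<^sub>m 1\<^sub>m (dim_row A) - cmat A) * cmat B + cmat D"

definition signature_mat :: "nat \<Rightarrow> real mat \<Rightarrow> bool" where
  "signature_mat m S \<longleftrightarrow>
     S \<in> carrier_mat m m \<and> diagonal_mat S \<and> (\<forall>i<m. S $$ (i, i) = 1 \<or> S $$ (i, i) = -1)"

(* \<Omega> is the set of points at which the m x m transfer function H is considered. *)
definition symmetric_on :: "complex set \<Rightarrow> nat \<Rightarrow> (complex \<Rightarrow> complex mat) \<Rightarrow> bool" where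
  "symmetric_on \<Omega> m H \<longleftrightarrow>
     (\<exists>S. signature_mat m S \<and> (\<forall>s\<in>\<Omega>. cmat S * transpose_mat (H s) = H s * cmat S))"

definition symmetrizable :: "real mat \<Rightarrow> real mat \<Rightarrow> real mat \<Rightarrow> real mat \<Rightarrow> bool" where
  "symmetrizable A B C D \<longleftrightarrow>
     (\<exists>K \<in> carrier_mat (dim_row D) (dim_row D). invertible_mat K \<and>
        symmetric_on (- spectrum (cmat A)) (dim_row D)
          (\<lambda>s. cmat (mat_inv K) * transfer_function A B C D s * cmat K))"

definition alg_mult :: "real mat \<Rightarrow> complex \<Rightarrow> nat" where
  "alg_mult P z = order z (char_poly (cmat P))"

(* ls lists the p distinct real eigenvalues, followed by one representative (either one) of
   each of the q distinct pairs of non-real conjugate eigenvalues. *)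
definition eigenvalue_listing :: "real mat \<Rightarrow> nat \<Rightarrow> nat \<Rightarrow> complex list \<Rightarrow> bool" where
  "eigenvalue_listing P p q ls \<longleftrightarrow>
     length ls = p + q \<and>
     (\<forall>j<p. ls ! j \<in> \<real>) \<and>
     (\<forall>j. p \<le> j \<and> j < p + q \<longrightarrow> ls ! j \<notin> \<real>) \<and>
     (\<forall>i<p + q. \<forall>j<p + q. i \<noteq> j \<longrightarrow> {ls ! i, cnj (ls ! i)} \<inter> {ls ! j, cnj (ls ! j)} = {}) \<and>
     spectrum (cmat P) = (\<Union>z\<in>set ls. {z, cnj z})"

definition block_size :: "real mat \<Rightarrow> complex \<Rightarrow> nat" where
  "block_size P z = (if z \<in> \<real> then alg_mult P z else 2 * alg_mult P z)"

(* For non-real z = a + i b: the 2k x 2k matrix with k diagonal blocks [[a, b], [-b, a]] and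
   2 x 2 identity blocks above them.  Replacing z by its conjugate gives the variant with
   diagonal blocks [[a, -b], [b, a]]. *)
definition real_jordan_block :: "complex \<Rightarrow> nat \<Rightarrow> real mat" where
  "real_jordan_block z k =
     (if z \<in> \<real> then jordan_block k (Re z)
      else mat (2 * k) (2 * k) (\<lambda>(i, j).
        if i div 2 = j div 2 then (if i = j then Re z else if i < j then Im z else - Im z)
        else if j = i + 2 then 1 else 0))"

definition real_jordan_normal_form :: "real mat \<Rightarrow> complex list \<Rightarrow> real mat \<Rightarrow> bool" where
  "real_jordan_normal_form P ls V \<longleftrightarrow>
     V \<in> carrier_mat (dim_row P) (dim_row P) \<and> invertible_mat V \<and>
     (\<exists>Js. length Js = length ls \<and>
        (\<forall>j<length ls.
           Js ! j \<in> carrier_mat (block_size P (ls ! j)) (block_size P (ls ! j)) \<and>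
           (\<exists>ks. 0 \<notin> set ks \<and> Js ! j = diag_block_mat (map (real_jordan_block (ls ! j)) ks))) \<and>
        mat_inv V * P * V = diag_block_mat Js)"

(* The j-th block of M under the column partition into blocks of ts ! 0, ts ! 1, ... columns. *)
definition col_block :: "nat list \<Rightarrow> 'a mat \<Rightarrow> nat \<Rightarrow> 'a mat" where
  "col_block ts M j =
     mat (dim_row M) (ts ! j) (\<lambda>(i, k). M $$ (i, sum_list (take j ts) + k))"

definition kronecker :: "'a :: times mat \<Rightarrow> 'a mat \<Rightarrow> 'a mat" where
  "kronecker M N =
     mat (dim_row M * dim_row N) (dim_col M * dim_col N)
       (\<lambda>(i, j). M $$ (i div dim_row N, j div dim_col N) * N $$ (i mod dim_row N, j mod dim_col N))"

definition khatri_rao :: "nat list \<Rightarrow> 'a :: times mat \<Rightarrow> 'a mat \<Rightarrow> 'a mat" where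
  "khatri_rao ts Z W =
     mat_of_cols (dim_row Z * dim_row W)
       (concat (map (\<lambda>j. cols (kronecker (col_block ts Z j) (col_block ts W j))) [0..<length ts]))"

end

theory Submission
  imports Defs
begin

text \<open>
Symmetrizability of the transfer function \<open>G\<close> means that some nonzero (in fact invertible)
real matrix \<open>S = K \<Sigma> K\<^sup>T\<close> satisfies \<open>S G(s)\<^sup>T = G(s) S\<close> off the spectrum of \<open>A\<close>
(\<open>symmetrizable_imp_symmetrizer\<close>). The idea is to turn this external symmetry into a linear
relation between the columns of the Khatri-Rao product.

The first step makes the symmetry internal. Both sides of \<open>S G\<^sup>T = G S\<close> are transfer
functions, one realized by \<open>(A\<^sup>T, C\<^sup>T, S B\<^sup>T, S D\<^sup>T)\<close> and one by \<open>(A, B S, C, D S)\<close>; comparing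
their behaviour as \<open>s\<close> tends to infinity shows that their Markov parameters agree
(\<open>symmetrizer_markov\<close>). As in the state space isomorphism theorem, observability then produces
an intertwining matrix \<open>T\<close> with \<open>A T = T A\<^sup>T\<close>, \<open>B S = T C\<^sup>T\<close>, \<open>C T = S B\<^sup>T\<close>
(\<open>observable_symmetrizer_extends\<close>). Together with \<open>D S = S D\<^sup>T\<close> this says that
\<open>X = diag(T, S)\<close> satisfies \<open>P X = X P\<^sup>T\<close>.

The second step passes to Jordan coordinates. With \<open>J = inv(V) P V\<close> and
\<open>Y = inv(V) X inv(V)\<^sup>T\<close> the relation becomes \<open>J Y = Y J\<^sup>T\<close>. The off-diagonal blocks of \<open>Y\<close>
solve Sylvester equations whose two coefficient matrices have disjoint spectra, so they vanish
and \<open>Y\<close> is block diagonal (\<open>symmetrizer_block_diagonal\<close>). On the other hand \<open>V Y V\<^sup>T = X\<close> has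
zero upper right block, that is \<open>W Y Z\<^sup>T = \<Sum>\<^sub>j W\<^sub>j Y\<^sub>j Z\<^sub>j\<^sup>T = 0\<close>. After vectorization this is
a linear relation between the \<open>t\<^sub>1\<^sup>2 + ... + t\<^sub>r\<^sup>2\<close> columns of \<open>Z * W\<close>, whose coefficients are
the entries of the blocks \<open>Y\<^sub>j\<close>. They are not all zero because \<open>S\<close>, hence \<open>X\<close>, hence \<open>Y\<close>, is
nonzero (\<open>block_diagonal_relation_imp_khatri_rao_rank_deficient\<close>).
\<close>

section \<open>Rank, inverses and the Sylvester equation\<close>

text \<open>
If the columns are distinct, a kernel vector is a linear dependence between them; if two
columns coincide, the set of columns already has fewer than \<open>nc\<close> elements. The second case
needs separate treatment because rank is defined through the set of columns.
\<close>

lemma rank_less_if_kernel_nontrivial: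
  fixes M :: "'a::field mat"
  assumes M: "M \<in> carrier_mat nr nc" and v: "v \<in> carrier_vec nc" "v \<noteq> 0\<^sub>v nc"
    and Mv: "M *\<^sub>v v = 0\<^sub>v nr"
  shows "mat_rank M < nc"
proof -
  interpret vec_space "TYPE('a)" nr .
  have dim: "dim_row M = nr" using M by simp
  have "rank M \<noteq> nc" if "distinct (cols M)"
    using full_rank_lin_indpt[OF M _ that] lin_depI[OF M v Mv that] by blast
  moreover have "rank M \<noteq> nc" if nd: "\<not> distinct (cols M)"
  proof -
    obtain S where S: "maximal S (\<lambda>T. T \<subseteq> set (cols M) \<and> lin_indpt T)"
      using maximal_exists[of "(\<lambda>T. T \<subseteq> set (cols M) \<and> lin_indpt T)" "card (set (cols M))" "{}"]
      by (meson List.finite_set card_mono empty_iff empty_subsetI finite_lin_indpt2 rev_finite_subset)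
    then have "card S \<le> card (set (cols M))" by (simp add: card_mono maximal_def)
    also have "\<dots> < length (cols M)" using nd card_distinct card_length le_neq_implies_less by blast
    finally show ?thesis using rank_card_indpt[OF M S] M by simp
  qed
  ultimately show ?thesis using rank_le_nc[OF M] unfolding dim by fastforce
qed

lemma mat_inv_inverse:
  fixes M :: "'a::field mat"
  assumes M: "M \<in> carrier_mat n n" and det: "det M \<noteq> 0"
  shows "mat_inv M \<in> carrier_mat n n" "M * mat_inv M = 1\<^sub>m n" "mat_inv M * M = 1\<^sub>m n"
proof -
  have "mat_inverse M \<noteq> None"
    using mat_inverse(1)[OF M, of undefined] det_non_zero_imp_unit[OF M det, of undefined] by blast
  then obtain N where "mat_inverse M = Some N" by blast
  with mat_inverse(2)[OF M this]
  show "mat_inv M \<in> carrier_mat n n" "M * mat_inv M = 1\<^sub>m n" "mat_inv M * M = 1\<^sub>m n" by auto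
qed

lemma invertible_mat_det_nonzero:
  fixes M :: "'a::field mat"
  assumes M: "M \<in> carrier_mat n n" and inv: "invertible_mat M"
  shows "det M \<noteq> 0"
proof -
  from inv obtain N where N: "M * N = 1\<^sub>m n" "N * M = 1\<^sub>m (dim_row N)"
    unfolding invertible_mat_def inverts_mat_def using M by auto
  have "dim_col N = n" using arg_cong[OF N(1), of dim_col] by simp
  moreover have "dim_row N = n" using arg_cong[OF N(2), of dim_col] M by simp
  ultimately have "N \<in> carrier_mat n n" by auto
  from det_mult[OF M this] N(1) show ?thesis by auto
qed

text \<open>
Triangularize \<open>B\<close> and absorb the change of basis into \<open>Y\<close>. For upper triangular \<open>U\<close>, the
equation \<open>A X = X U\<close> forces the first nonzero column of \<open>X\<close> to be an eigenvector of \<open>A\<close> for a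
diagonal entry of \<open>U\<close>, which is an eigenvalue of \<open>B\<close>.
\<close>

lemma sylvester_only_zero_solution:
  fixes A B Y :: "complex mat"
  assumes A: "A \<in> carrier_mat n n" and B: "B \<in> carrier_mat m m" and Y: "Y \<in> carrier_mat n m"
    and AY: "A * Y = Y * B"
    and disj: "spectrum A \<inter> spectrum B = {}"
  shows "Y = 0\<^sub>m n m"
proof -
  from char_poly_factorized[OF B] obtain es where "char_poly B = (\<Prod>a\<leftarrow>es. [:- a, 1:])" by auto
  from schur_decomposition_exists[OF B this] obtain U where
    U: "U \<in> carrier_mat m m" "upper_triangular U" "similar_mat B U" by blast
  then obtain P Q where PQ: "similar_mat_wit B U P Q" unfolding similar_mat_def by blast
  note w = similar_mat_witD2[OF B PQ]
  define X where "X = Y * P"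
  have X: "X \<in> carrier_mat n m" unfolding X_def using Y w by auto
  have YX: "Y = X * Q"
  proof -
    have "X * Q = Y * (P * Q)" unfolding X_def using Y w by (intro assoc_mult_mat) auto
    thus ?thesis using w Y by simp
  qed
  have AX: "A * X = X * U"
  proof -
    have "A * X = Y * B * P" unfolding X_def AY[symmetric] using A Y w by (intro assoc_mult_mat[symmetric]) auto
    also have "\<dots> = Y * (P * U * Q * P)"
      unfolding w(3)[symmetric] using Y w B by (intro assoc_mult_mat) auto
    also have "P * U * Q * P = P * U * (Q * P)" using w by (intro assoc_mult_mat) auto
    also have "\<dots> = P * U" using w by simp
    also have "Y * (P * U) = X * U" unfolding X_def using Y w by (intro assoc_mult_mat[symmetric]) auto
    finally show ?thesis .
  qed
  have "col X j = 0\<^sub>v n" if "j < m" for j using that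
  proof (induction j rule: less_induct)
    case (less j)
    have z: "X $$ (i, k) = 0" if "k < j" "i < n" for i k
    proof -
      have "col X k = 0\<^sub>v n" using less that by simp
      hence "col X k $ i = 0" using that by simp
      thus ?thesis using that less.prems X by simp
    qed
    have "A *\<^sub>v col X j = col (A * X) j" by (rule col_mult2[OF A X less.prems, symmetric])
    also have "\<dots> = U $$ (j, j) \<cdot>\<^sub>v col X j"
    proof (rule eq_vecI)
      fix i assume "i < dim_vec (U $$ (j, j) \<cdot>\<^sub>v col X j)"
      hence i: "i < n" using X by simp
      have "col (A * X) j $ i = (\<Sum>k = 0..<m. X $$ (i, k) * U $$ (k, j))"
        unfolding AX using X U i less by (simp add: scalar_prod_def)
      also have "\<dots> = (\<Sum>k\<in>{j}. X $$ (i, k) * U $$ (k, j))"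
      proof (rule sum.mono_neutral_right)
        show "\<forall>k\<in>{0..<m} - {j}. X $$ (i, k) * U $$ (k, j) = 0"
        proof
          fix k assume "k \<in> {0..<m} - {j}"
          then consider "k < j" | "j < k" "k < m" by fastforce
          thus "X $$ (i, k) * U $$ (k, j) = 0"
            using z[of k i] i upper_triangularD[OF U(2), of j k] U(1) by cases auto
        qed
      qed (use less in auto)
      finally show "col (A * X) j $ i = (U $$ (j, j) \<cdot>\<^sub>v col X j) $ i" using X i less by simp
    qed (use A X in auto)
    finally have eq: "A *\<^sub>v col X j = U $$ (j, j) \<cdot>\<^sub>v col X j" .
    show ?case
    proof (rule ccontr)
      assume "col X j \<noteq> 0\<^sub>v n"
      hence "eigenvalue A (U $$ (j, j))"
        unfolding eigenvalue_def eigenvector_def using eq A X by (intro exI[of _ "col X j"]) auto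
      moreover have "poly (char_poly U) (U $$ (j, j)) = 0"
      proof -
        have "U $$ (j, j) \<in> set (diag_mat U)" using less U by (auto simp: diag_mat_def)
        thus ?thesis unfolding char_poly_upper_triangular[OF U(1,2)]
          by (auto simp: poly_prod_list prod_list_zero_iff image_iff intro!: bexI)
      qed
      hence "eigenvalue B (U $$ (j, j))"
        using char_poly_similar[OF U(3)] eigenvalue_root_char_poly[OF B] by simp
      ultimately show False using disj unfolding spectrum_def by auto
    qed
  qed
  hence "X = 0\<^sub>m n m" using X by (intro mat_col_eqI) auto
  thus ?thesis using YX w by simp
qed

text \<open>
In the non-real case the block is block upper triangular with \<open>2 \<times> 2\<close> diagonal blocks. The
last coordinate pair \<open>(a, b)\<close> on which an eigenvector does not vanish is an eigenvector of the
\<open>2 \<times> 2\<close> block, whose characteristic polynomial is \<open>(x - z) (x - cnj z)\<close>.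
\<close>

lemma real_jordan_block_eigenvalue:
  assumes "eigenvalue (cmat (real_jordan_block z k)) x"
  shows "x = z \<or> x = cnj z"
proof (cases "z \<in> \<real>")
  case True
  have eq: "cmat (jordan_block k (Re z)) = jordan_block k z"
    using True by (intro eq_matI) (auto simp: jordan_block_def complex_is_Real_iff complex_eq_iff)
  have "poly (char_poly (jordan_block k z)) x = 0"
    using assms True eigenvalue_root_char_poly[OF jordan_block_carrier, of k z x]
    by (simp add: real_jordan_block_def eq)
  thus ?thesis by (auto simp: jordan_block_char_poly)
next
  case False
  define J where "J = cmat (real_jordan_block z k)"
  have J: "J \<in> carrier_mat (2 * k) (2 * k)"
    using False by (auto simp: J_def real_jordan_block_def)
  have Jij: "J $$ (i, j) = (if i div 2 = j div 2
      then (if i = j then Re z else if i < j then Im z else - Im z)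
      else if j = i + 2 then 1 else 0)" if "i < 2 * k" "j < 2 * k" for i j
    using that False by (auto simp: J_def real_jordan_block_def)
  obtain u where u: "u \<in> carrier_vec (2 * k)" "u \<noteq> 0\<^sub>v (2 * k)" "J *\<^sub>v u = x \<cdot>\<^sub>v u"
    using assms J unfolding J_def[symmetric] eigenvalue_def eigenvector_def by auto
  define N where "N = {i. i < 2 * k \<and> u $ i \<noteq> 0}"
  have "finite N" unfolding N_def by simp
  moreover have "N \<noteq> {}"
  proof
    assume "N = {}"
    hence "u = 0\<^sub>v (2 * k)" using u(1) by (intro eq_vecI) (auto simp: N_def)
    with u show False by simp
  qed
  ultimately have "Max N \<in> N" and mx: "\<And>i. i \<in> N \<Longrightarrow> i \<le> Max N" by auto
  define g where "g = Max N div 2"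
  define a b where "a = u $ (2 * g)" and "b = u $ (2 * g + 1)"
  have "Max N < 2 * k" using \<open>Max N \<in> N\<close> unfolding N_def by blast
  hence g: "2 * g + 1 < 2 * k" unfolding g_def by presburger
  have later: "u $ i = 0" if "2 * g + 1 < i" "i < 2 * k" for i
    proof (rule ccontr)
    assume "u $ i \<noteq> 0"
    hence "i \<le> Max N" using mx[of i] that unfolding N_def by blast
    thus False using that unfolding g_def by linarith
  qed
  have ab: "a \<noteq> 0 \<or> b \<noteq> 0"
  proof -
    have "Max N = 2 * g \<or> Max N = 2 * g + 1" unfolding g_def by linarith
    thus ?thesis using \<open>Max N \<in> N\<close> unfolding N_def a_def b_def by auto
  qed
  have row: "x * u $ i = J $$ (i, 2 * g) * a + J $$ (i, 2 * g + 1) * b"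
    if i: "i = 2 * g \<or> i = 2 * g + 1" for i
  proof -
    have il: "i < 2 * k" using i g by auto
    have "x * u $ i = (J *\<^sub>v u) $ i" using u il by simp
    also have "\<dots> = (\<Sum>j = 0..<2 * k. J $$ (i, j) * u $ j)"
      using J u(1) il by (simp add: scalar_prod_def)
    also have "\<dots> = (\<Sum>j\<in>{2 * g, 2 * g + 1}. J $$ (i, j) * u $ j)"
    proof (rule sum.mono_neutral_right)
      show "\<forall>j\<in>{0..<2 * k} - {2 * g, 2 * g + 1}. J $$ (i, j) * u $ j = 0"
      proof
        fix j assume j: "j \<in> {0..<2 * k} - {2 * g, 2 * g + 1}"
        show "J $$ (i, j) * u $ j = 0"
        proof (cases "j < 2 * g")
          case True
          thus ?thesis using i j il by (subst Jij) auto
        next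
          case False
          thus ?thesis using j later[of j] by auto
        qed
      qed
    qed (use g in auto)
    finally show ?thesis by (simp add: a_def b_def)
  qed
  have e1: "x * a = Re z * a + Im z * b"
    using row[of "2 * g"] g by (simp add: Jij a_def)
  have e2: "x * b = - Im z * a + Re z * b"
    using row[of "2 * g + 1"] g by (simp add: Jij b_def)
  define r m :: complex where "r = Re z" and "m = Im z"
  have f: "(x - r) * a = m * b" "(x - r) * b = - (m * a)"
    using e1 e2 by (simp_all add: r_def m_def algebra_simps)
  have "(x - r) * ((x - r) * a) = - (m * (m * a))" "(x - r) * ((x - r) * b) = - (m * (m * b))"
    unfolding f using f by (simp_all add: mult.left_commute[of "x - r" m])
  hence "((x - r) * (x - r) + m * m) * a = 0" "((x - r) * (x - r) + m * m) * b = 0"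
    by (simp_all add: distrib_right mult.assoc)
  hence "(x - r) * (x - r) + m * m = 0" using ab by auto
  moreover have "(x - (r + \<i> * m)) * (x - (r - \<i> * m)) = (x - r) * (x - r) + m * m"
    by (simp add: algebra_simps)
  moreover have "z = r + \<i> * m" "cnj z = r - \<i> * m"
    by (auto simp: complex_eq_iff r_def m_def)
  ultimately show ?thesis by (metis eq_iff_diff_eq_0 mult_eq_0_iff)
qed

lemma char_poly_diag_block_mat:
  fixes As :: "complex mat list"
  assumes "Ball (set As) square_mat"
  shows "char_poly (diag_block_mat As) = prod_list (map char_poly As)"
  using assms
proof (induction As)
  case Nil
  show ?case by (simp add: char_poly_def char_poly_matrix_def)
next
  case (Cons A As)
  let ?D = "diag_block_mat As"
  obtain a d where A: "A \<in> carrier_mat a a" and D: "?D \<in> carrier_mat d d"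
    using Cons.prems diag_block_mat_square[of As]
    by (metis carrier_matI list.set_intros square_mat.elims(2))
  have "diag_block_mat (A # As) = four_block_mat A (0\<^sub>m a d) (0\<^sub>m d a) ?D"
    using carrier_matD[OF A] carrier_matD[OF D] by (simp add: Let_def)
  hence "char_poly (diag_block_mat (A # As)) = char_poly A * char_poly ?D"
    by (rule char_poly_0_block[OF _ _ _ A zero_carrier_mat D])
       (use char_poly_factorized[OF A] char_poly_factorized[OF D] in blast)+
  also have "char_poly ?D = prod_list (map char_poly As)"
    using Cons.prems by (intro Cons.IH) auto
  finally show ?case by simp
qed

lemma map_mat_diag_block_mat:
  fixes f :: "'a::zero \<Rightarrow> 'b::zero"
  assumes "f 0 = 0"
  shows "map_mat f (diag_block_mat As) = diag_block_mat (map (map_mat f) As)"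
proof (induction As)
  case (Cons A As)
  have "dim_row (diag_block_mat (map (map_mat f) As)) = dim_row (diag_block_mat As)"
    "dim_col (diag_block_mat (map (map_mat f) As)) = dim_col (diag_block_mat As)"
    by (auto simp: Cons[symmetric])
  thus ?case by (auto simp: Let_def Cons[symmetric] assms intro!: eq_matI)
qed auto

lemma square_real_jordan_block: "square_mat (real_jordan_block z k)"
  by (auto simp: real_jordan_block_def)

lemma spectrum_real_jordan_blocks:
  "spectrum (cmat (diag_block_mat (map (real_jordan_block z) ks))) \<subseteq> {z, cnj z}"
proof
  let ?As = "map (\<lambda>k. cmat (real_jordan_block z k)) ks"
  let ?J = "diag_block_mat ?As"
  fix x assume x: "x \<in> spectrum (cmat (diag_block_mat (map (real_jordan_block z) ks)))"
  have sq: "Ball (set ?As) square_mat" using square_real_jordan_block by auto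
  hence J: "?J \<in> carrier_mat (dim_row ?J) (dim_row ?J)"
    using diag_block_mat_square[of ?As] by auto
  have "eigenvalue ?J x"
    using x by (simp add: spectrum_def map_mat_diag_block_mat o_def)
  hence "poly (prod_list (map char_poly ?As)) x = 0"
    unfolding eigenvalue_root_char_poly[OF J] char_poly_diag_block_mat[OF sq] .
  then obtain k where "poly (char_poly (cmat (real_jordan_block z k))) x = 0"
    by (auto simp: poly_prod_list prod_list_zero_iff)
  hence "eigenvalue (cmat (real_jordan_block z k)) x"
    by (subst eigenvalue_root_char_poly[of _ "dim_row (real_jordan_block z k)"])
       (use square_real_jordan_block in auto)
  thus "x \<in> {z, cnj z}" using real_jordan_block_eigenvalue by auto
qed

section \<open>Transfer functions and Markov parameters\<close>

text \<open>
In column \<open>j\<close> of \<open>s R = 1 + A R\<close>, compare moduli in the row \<open>l\<close> where \<open>\<bar>R\<^sub>l\<^sub>j\<bar>\<close> is largest: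
\<open>\<bar>s\<bar> \<bar>R\<^sub>l\<^sub>j\<bar> \<le> 1 + a \<bar>R\<^sub>l\<^sub>j\<bar>\<close>.
\<close>

lemma resolvent_entry_bound:
  fixes A R :: "complex mat"
  assumes A: "A \<in> carrier_mat n n" and R: "R \<in> carrier_mat n n"
    and res: "s \<cdot>\<^sub>m R = 1\<^sub>m n + A * R"
    and a: "a = (\<Sum>i<n. \<Sum>k<n. cmod (A $$ (i, k)))" and s: "a < cmod s"
    and ij: "i < n" "j < n"
  shows "cmod (R $$ (i, j)) \<le> 1 / (cmod s - a)"
proof -
  define f where "f = (\<lambda>i. cmod (R $$ (i, j)))"
  have "finite (f ` {..<n})" "f ` {..<n} \<noteq> {}" using ij by auto
  hence "Max (f ` {..<n}) \<in> f ` {..<n}" and mx: "\<And>k. k < n \<Longrightarrow> f k \<le> Max (f ` {..<n})" by auto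
  then obtain l where l: "l < n" "Max (f ` {..<n}) = f l" by auto
  have "s * R $$ (l, j) = (s \<cdot>\<^sub>m R) $$ (l, j)" using R l ij by simp
  also have "\<dots> = (1\<^sub>m n + A * R) $$ (l, j)" unfolding res ..
  also have "\<dots> = (if l = j then 1 else 0) + (\<Sum>k<n. A $$ (l, k) * R $$ (k, j))"
    using A R l ij by (simp add: scalar_prod_def atLeast0LessThan)
  finally have "cmod s * f l = cmod ((if l = j then 1 else 0) + (\<Sum>k<n. A $$ (l, k) * R $$ (k, j)))"
    unfolding f_def by (metis norm_mult)
  also have "\<dots> \<le> 1 + (\<Sum>k<n. cmod (A $$ (l, k)) * f k)"
    by (rule order_trans[OF norm_triangle_ineq], rule add_mono)
       (auto simp: f_def norm_mult intro!: order_trans[OF norm_sum])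
  \<comment> \<open>Row \<open>l\<close> was chosen to maximize \<open>f\<close>.\<close>
  also have "(\<Sum>k<n. cmod (A $$ (l, k)) * f k) \<le> (\<Sum>k<n. cmod (A $$ (l, k)) * f l)"
    using mx l by (intro sum_mono mult_left_mono) auto
  also have "\<dots> = (\<Sum>k<n. cmod (A $$ (l, k))) * f l" by (simp add: sum_distrib_right)
  also have "\<dots> \<le> a * f l"
  proof (rule mult_right_mono)
    show "(\<Sum>k<n. cmod (A $$ (l, k))) \<le> a" unfolding a
      using l by (intro member_le_sum[where f = "\<lambda>i. \<Sum>k<n. cmod (A $$ (i, k))"]) (auto intro: sum_nonneg)
  qed (simp add: f_def)
  finally have "f l * (cmod s - a) \<le> 1" by (simp add: algebra_simps)
  hence "f l \<le> 1 / (cmod s - a)" using s by (simp add: field_simps)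
  with mx[OF ij(1)] l show ?thesis by (simp add: f_def)
qed

text \<open>
The resolvent sampled at the points \<open>s = k\<close> for natural \<open>k\<close>, which eventually leave the
spectrum; such samples determine a rational function. Only the identity \<open>s R(s) = 1 + A R(s)\<close>
is recorded, as this is what drives the expansion at infinity.
\<close>

definition resolvent_seq :: "nat \<Rightarrow> complex mat \<Rightarrow> (nat \<Rightarrow> complex mat) \<Rightarrow> bool" where
  "resolvent_seq n A R \<longleftrightarrow> A \<in> carrier_mat n n \<and> (\<forall>k. R k \<in> carrier_mat n n) \<and>
     (\<forall>\<^sub>F k in sequentially. of_nat k \<cdot>\<^sub>m R k = 1\<^sub>m n + A * R k)"

lemma resolvent_seq_entry_tendsto_0:
  assumes "resolvent_seq n A R" and ij: "i < n" "j < n"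
  shows "(\<lambda>k. R k $$ (i, j)) \<longlonglongrightarrow> 0"
proof -
  define a where "a = (\<Sum>i<n. \<Sum>k<n. cmod (A $$ (i, k)))"
  have R: "A \<in> carrier_mat n n" "\<And>k. R k \<in> carrier_mat n n"
    "\<forall>\<^sub>F k in sequentially. of_nat k \<cdot>\<^sub>m R k = 1\<^sub>m n + A * R k"
    using assms(1) by (auto simp: resolvent_seq_def)
  have "\<forall>\<^sub>F k in sequentially. a < real k"
    using filterlim_real_sequentially by (simp add: filterlim_at_top_dense)
  with R(3) have "\<forall>\<^sub>F k in sequentially. norm (R k $$ (i, j)) \<le> 1 / (real k - a)"
  proof eventually_elim
    case (elim k)
    thus ?case using resolvent_entry_bound[OF R(1,2) elim(1) a_def _ ij] by simp
  qed
  hence "\<forall>\<^sub>F k in sequentially. norm (R k $$ (i, j)) \<le> norm (1 / (real k - a)) * 1"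
    by (rule eventually_mono) (metis abs_ge_self mult.right_neutral order_trans real_norm_def)
  moreover have "(\<lambda>k. 1 / (real k - a)) \<longlonglongrightarrow> 0"
    by (rule real_tendsto_divide_at_top[OF tendsto_const])
       (use filterlim_tendsto_add_at_top[OF tendsto_const[of "-a"] filterlim_real_sequentially] in simp)
  ultimately show ?thesis by (rule tendsto_0_le[rotated])
qed

lemma mat_mult_entry:
  assumes "M \<in> carrier_mat a b" "N \<in> carrier_mat b c" "i < a" "j < c"
  shows "(M * N) $$ (i, j) = (\<Sum>k<b. M $$ (i, k) * N $$ (k, j))"
  using assms by (simp add: scalar_prod_def atLeast0LessThan)

lemma resolvent_seq_strictly_proper:
  assumes R: "resolvent_seq n A R" and X: "X \<in> carrier_mat p n" and Y: "Y \<in> carrier_mat n q"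
    and ij: "i < p" "j < q"
  shows "(\<lambda>k. (X * R k * Y) $$ (i, j)) \<longlonglongrightarrow> 0"
proof -
  have Rk: "R k \<in> carrier_mat n n" for k using R by (simp add: resolvent_seq_def)
  have "(X * R k * Y) $$ (i, j) = (\<Sum>b<n. (\<Sum>a<n. X $$ (i, a) * R k $$ (a, b)) * Y $$ (b, j))" for k
    using mat_mult_entry[OF mult_carrier_mat[OF X Rk] Y ij] mat_mult_entry[OF X Rk ij(1)] by simp
  moreover have "(\<lambda>k. \<Sum>b<n. (\<Sum>a<n. X $$ (i, a) * R k $$ (a, b)) * Y $$ (b, j)) \<longlonglongrightarrow>
      (\<Sum>b<n. (\<Sum>a<n. X $$ (i, a) * 0) * Y $$ (b, j))"
    by (intro tendsto_sum tendsto_mult tendsto_const resolvent_seq_entry_tendsto_0[OF R]) auto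
  ultimately show ?thesis by simp
qed

text \<open>
The feedthrough matrix is the value of the transfer function at infinity.
\<close>

lemma feedthrough_unique:
  assumes R: "resolvent_seq n A R" "resolvent_seq n A' R'"
    and c: "X \<in> carrier_mat p n" "Y \<in> carrier_mat n q" "U \<in> carrier_mat p q"
      "X' \<in> carrier_mat p n" "Y' \<in> carrier_mat n q" "U' \<in> carrier_mat p q"
    and eq: "\<forall>\<^sub>F k in sequentially. X * R k * Y + U = X' * R' k * Y' + U'"
  shows "U = U'"
proof (rule eq_matI)
  fix i j assume "i < dim_row U'" "j < dim_col U'"
  hence ij: "i < p" "j < q" using c by auto
  have Rk: "R k \<in> carrier_mat n n" "R' k \<in> carrier_mat n n" for k
    using R by (simp_all add: resolvent_seq_def)
  have lim: "(\<lambda>k. (X * R k * Y + U) $$ (i, j)) \<longlonglongrightarrow> 0 + U $$ (i, j)"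
    "(\<lambda>k. (X' * R' k * Y' + U') $$ (i, j)) \<longlonglongrightarrow> 0 + U' $$ (i, j)"
    using tendsto_add[OF resolvent_seq_strictly_proper[OF R(1) c(1,2) ij] tendsto_const, of "U $$ (i, j)"]
      tendsto_add[OF resolvent_seq_strictly_proper[OF R(2) c(4,5) ij] tendsto_const, of "U' $$ (i, j)"]
    using c ij by simp_all
  have "(\<lambda>k. (X' * R' k * Y' + U') $$ (i, j)) \<longlonglongrightarrow> 0 + U $$ (i, j)"
    by (rule Lim_transform_eventually[OF lim(1)]) (use eq in \<open>auto elim: eventually_mono\<close>)
  from LIMSEQ_unique[OF this lim(2)] show "U $$ (i, j) = U' $$ (i, j)" by simp
qed (use c in auto)

text \<open>
Multiplying a transfer function by \<open>s\<close> moves its next Markov parameter \<open>X Y\<close> into the place of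
the feedthrough matrix.
\<close>

lemma resolvent_shift:
  assumes A: "A \<in> carrier_mat n n" and R: "R \<in> carrier_mat n n"
    and res: "s \<cdot>\<^sub>m R = 1\<^sub>m n + A * R"
    and X: "X \<in> carrier_mat p n" and Y: "Y \<in> carrier_mat n q"
  shows "s \<cdot>\<^sub>m (X * R * Y) = (X * A) * R * Y + X * (Y :: complex mat)"
proof -
  have "s \<cdot>\<^sub>m (X * R * Y) = X * (s \<cdot>\<^sub>m R) * Y"
    using X R Y by (simp add: mult_smult_distrib mult_smult_assoc_mat[of _ p n])
  also have "X * (s \<cdot>\<^sub>m R) = X + X * A * R"
    unfolding res using X A R
    by (subst mult_add_distrib_mat[of _ p n _ n]) (auto simp: assoc_mult_mat[of _ p n _ n _ n])
  also have "(X + X * A * R) * Y = X * Y + X * A * R * Y"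
    using X A R Y by (intro add_mult_distrib_mat[of _ p n]) auto
  also have "\<dots> = X * A * R * Y + X * Y"
    using X A R Y by (intro comm_add_mat[of _ p q]) auto
  finally show ?thesis .
qed

lemma pow_mat_commute:
  assumes A: "A \<in> carrier_mat n n"
  shows "A * A ^\<^sub>m j = A ^\<^sub>m j * A"
proof (induction j)
  case (Suc j)
  have "A * A ^\<^sub>m Suc j = (A * A ^\<^sub>m j) * A"
    using A pow_carrier_mat[OF A, of j] by (simp add: assoc_mult_mat[of _ n n _ n _ n])
  with Suc show ?case by simp
qed (use A in simp)

lemma markov_shift:
  assumes R: "resolvent_seq n A R" "resolvent_seq n A' R'"
    and c: "X \<in> carrier_mat p n" "Y \<in> carrier_mat n q" "U \<in> carrier_mat p q"
      "X' \<in> carrier_mat p n" "Y' \<in> carrier_mat n q" "U' \<in> carrier_mat p q"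
    and eq: "\<forall>\<^sub>F k in sequentially. X * R k * Y + U = X' * R' k * Y' + U'"
  shows "\<forall>\<^sub>F k in sequentially. X * A * R k * Y + X * Y = X' * A' * R' k * Y' + X' * Y'"
proof -
  have A: "A \<in> carrier_mat n n" "A' \<in> carrier_mat n n"
    and Rk: "\<And>k. R k \<in> carrier_mat n n" "\<And>k. R' k \<in> carrier_mat n n"
    using R by (simp_all add: resolvent_seq_def)
  have UU: "U = U'" by (rule feedthrough_unique[OF R c eq])
  have "\<forall>\<^sub>F k in sequentially. of_nat k \<cdot>\<^sub>m R k = 1\<^sub>m n + A * R k \<and>
      of_nat k \<cdot>\<^sub>m R' k = 1\<^sub>m n + A' * R' k"
    using R unfolding resolvent_seq_def by (auto intro: eventually_conj)
  with eq show ?thesis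
  proof eventually_elim
    case (elim k)
    have "X * R k * Y = X * R k * Y + U - U" using c(1-3) Rk by (intro eq_matI) auto
    also have "\<dots> = X' * R' k * Y'"
      unfolding elim(1) unfolding UU using c(4-6) Rk by (intro eq_matI) auto
    finally have "of_nat k \<cdot>\<^sub>m (X * R k * Y) = of_nat k \<cdot>\<^sub>m (X' * R' k * Y')" by simp
    thus ?case
      using resolvent_shift[OF A(1) Rk(1) conjunct1[OF elim(2)] c(1,2)]
        resolvent_shift[OF A(2) Rk(2) conjunct2[OF elim(2)] c(4,5)]
      by simp
  qed
qed

text \<open>
Peel off the Laurent coefficients at infinity one at a time: each is a feedthrough matrix
after enough applications of \<open>markov_shift\<close>.
\<close>

lemma markov_parameters_unique:
  assumes R: "resolvent_seq n A R" "resolvent_seq n A' R'"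
    and Y: "Y \<in> carrier_mat n q" "Y' \<in> carrier_mat n q"
    and c: "X \<in> carrier_mat p n" "X' \<in> carrier_mat p n" "U \<in> carrier_mat p q" "U' \<in> carrier_mat p q"
    and eq: "\<forall>\<^sub>F k in sequentially. X * R k * Y + U = X' * R' k * Y' + U'"
  shows "X * (A ^\<^sub>m j * Y) = X' * (A' ^\<^sub>m j * Y')"
  using c eq
proof (induction j arbitrary: X U X' U')
  case (0 X U X' U')
  have A: "A \<in> carrier_mat n n" "A' \<in> carrier_mat n n"
    using R by (simp_all add: resolvent_seq_def)
  have "X * Y = X' * Y'"
    by (rule feedthrough_unique[OF R _ _ _ _ _ _ markov_shift[OF R _ _ _ _ _ _ "0.prems"(5)]])
       (use "0.prems"(1-4) Y A in auto)
  thus ?case using A Y by simp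
next
  case (Suc j X U X' U')
  have A: "A \<in> carrier_mat n n" "A' \<in> carrier_mat n n"
    using R by (simp_all add: resolvent_seq_def)
  have "X * A * (A ^\<^sub>m j * Y) = X' * A' * (A' ^\<^sub>m j * Y')"
    by (rule Suc.IH[OF _ _ _ _ markov_shift[OF R _ _ _ _ _ _ Suc.prems(5)]])
       (use Suc.prems(1-4) Y A in auto)
  moreover have "Z * M * (M ^\<^sub>m j * V) = Z * (M ^\<^sub>m Suc j * V)"
    if "Z \<in> carrier_mat p n" "M \<in> carrier_mat n n" "V \<in> carrier_mat n q" for Z M V :: "complex mat"
  proof -
    have Mj: "M ^\<^sub>m j \<in> carrier_mat n n" using that by (intro pow_carrier_mat)
    have "Z * M * (M ^\<^sub>m j * V) = Z * (M * (M ^\<^sub>m j * V))"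
      using that Mj by (intro assoc_mult_mat) auto
    also have "M * (M ^\<^sub>m j * V) = M * M ^\<^sub>m j * V"
      using that Mj by (intro assoc_mult_mat[symmetric]) auto
    finally show ?thesis using pow_mat_commute[OF that(2)] by simp
  qed
  ultimately show ?case using Suc.prems(1-4) Y A by metis
qed

lemma resolvent_seq_of_mat_inv:
  assumes A: "A \<in> carrier_mat n n"
  obtains R where "resolvent_seq n A R" "resolvent_seq n A\<^sup>T (\<lambda>k. (R k)\<^sup>T)"
    "\<forall>\<^sub>F k in sequentially. of_nat k \<notin> spectrum A \<and> R k = mat_inv (of_nat k \<cdot>\<^sub>m 1\<^sub>m n - A)"
proof -
  \<comment> \<open>The zero matrix is a default value at the finitely many \<open>k\<close> in the spectrum.\<close>
  define R where "R = (\<lambda>k. if of_nat k \<in> spectrum A then 0\<^sub>m n n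
    else mat_inv (of_nat k \<cdot>\<^sub>m 1\<^sub>m n - A))"
  have "finite {k. of_nat k \<in> spectrum A}"
    using finite_vimageI[OF card_finite_spectrum(1)[OF A], of of_nat] by (auto simp: inj_on_def vimage_def)
  hence ev: "\<forall>\<^sub>F k in sequentially. of_nat k \<notin> spectrum A"
    unfolding cofinite_eq_sequentially[symmetric] eventually_cofinite by simp
  have inv: "mat_inv (s \<cdot>\<^sub>m 1\<^sub>m n - A) \<in> carrier_mat n n"
    "s \<cdot>\<^sub>m mat_inv (s \<cdot>\<^sub>m 1\<^sub>m n - A) = 1\<^sub>m n + A * mat_inv (s \<cdot>\<^sub>m 1\<^sub>m n - A)"
    "s \<cdot>\<^sub>m mat_inv (s \<cdot>\<^sub>m 1\<^sub>m n - A) = 1\<^sub>m n + mat_inv (s \<cdot>\<^sub>m 1\<^sub>m n - A) * A"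
    if s: "s \<notin> spectrum A" for s
  proof -
    let ?M = "s \<cdot>\<^sub>m 1\<^sub>m n - A"
    have M: "?M \<in> carrier_mat n n" using A by auto
    have "- char_matrix A s = ?M" using A by (auto simp: char_matrix_def)
    hence "det ?M \<noteq> 0"
      using s char_poly_matrix[OF A, of s] by (simp add: spectrum_root_char_poly[OF A])
    note i = mat_inv_inverse[OF M this]
    show "mat_inv ?M \<in> carrier_mat n n" by (rule i)
    have "?M * mat_inv ?M + A * mat_inv ?M = (?M + A) * mat_inv ?M"
      using A i(1) M by (intro add_mult_distrib_mat[symmetric]) auto
    also have "?M + A = s \<cdot>\<^sub>m 1\<^sub>m n" using A by auto
    also have "s \<cdot>\<^sub>m 1\<^sub>m n * mat_inv ?M = s \<cdot>\<^sub>m mat_inv ?M"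
      using i(1) by (simp add: mult_smult_assoc_mat[of _ n n])
    finally show "s \<cdot>\<^sub>m mat_inv ?M = 1\<^sub>m n + A * mat_inv ?M" using i by simp
    have "mat_inv ?M * ?M + mat_inv ?M * A = mat_inv ?M * (?M + A)"
      using A i(1) M by (intro mult_add_distrib_mat[symmetric]) auto
    also have "?M + A = s \<cdot>\<^sub>m 1\<^sub>m n" using A by auto
    also have "mat_inv ?M * (s \<cdot>\<^sub>m 1\<^sub>m n) = s \<cdot>\<^sub>m mat_inv ?M"
      using i(1) by (subst mult_smult_distrib[of _ n n _ n]) auto
    finally show "s \<cdot>\<^sub>m mat_inv ?M = 1\<^sub>m n + mat_inv ?M * A" using i by simp
  qed
  have Rk: "R k \<in> carrier_mat n n" for k unfolding R_def using inv(1) by simp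
  have "\<forall>\<^sub>F k in sequentially. of_nat k \<cdot>\<^sub>m R k = 1\<^sub>m n + A * R k"
    using ev
  proof eventually_elim
    case (elim k)
    thus ?case using inv(2)[OF elim] by (simp add: R_def)
  qed
  hence R1: "resolvent_seq n A R" unfolding resolvent_seq_def using A Rk by blast
  have "\<forall>\<^sub>F k in sequentially. of_nat k \<cdot>\<^sub>m (R k)\<^sup>T = 1\<^sub>m n + A\<^sup>T * (R k)\<^sup>T"
    using ev
  proof eventually_elim
    case (elim k)
    have "of_nat k \<cdot>\<^sub>m (R k)\<^sup>T = (of_nat k \<cdot>\<^sub>m R k)\<^sup>T" by (intro eq_matI) auto
    also have "of_nat k \<cdot>\<^sub>m R k = 1\<^sub>m n + R k * A" using inv(3)[OF elim] elim by (simp add: R_def)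
    also have "(1\<^sub>m n + R k * A)\<^sup>T = 1\<^sub>m n + A\<^sup>T * (R k)\<^sup>T"
      using Rk[of k] A by (subst transpose_add[of _ n n]) (auto simp: transpose_mult[of _ n n _ n])
    finally show ?case .
  qed
  hence R2: "resolvent_seq n A\<^sup>T (\<lambda>k. (R k)\<^sup>T)" unfolding resolvent_seq_def using A Rk by auto
  show ?thesis by (rule that[OF R1 R2]) (use ev in \<open>auto simp: R_def elim: eventually_mono\<close>)
qed

section \<open>Symmetrizers of the transfer function\<close>

lemma signature_mat_nonzero:
  assumes "signature_mat m S" "0 < m"
  shows "S \<noteq> 0\<^sub>m m m"
  using assms by (auto simp: signature_mat_def dest!: spec[of _ 0])

text \<open>
Undoing the change of basis \<open>K\<close> in \<open>\<Sigma> H\<^sup>T = H \<Sigma>\<close> with \<open>H = inv(K) G K\<close> turns \<open>\<Sigma>\<close> into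
\<open>S = K \<Sigma> K\<^sup>T\<close>.
\<close>

lemma symmetrizable_imp_symmetrizer:
  assumes c: "A \<in> carrier_mat n n" "B \<in> carrier_mat n m" "C \<in> carrier_mat m n" "D \<in> carrier_mat m m"
    and m: "0 < m" and sym: "symmetrizable A B C D"
  obtains S where "S \<in> carrier_mat m m" "S \<noteq> 0\<^sub>m m m"
    "\<And>s. s \<notin> spectrum (cmat A) \<Longrightarrow>
      cmat S * (transfer_function A B C D s)\<^sup>T = transfer_function A B C D s * cmat S"
proof -
  from sym c obtain K \<Sigma> where K: "K \<in> carrier_mat m m" "invertible_mat K"
    and \<Sigma>: "signature_mat m \<Sigma>"
    and eq: "\<And>s. s \<notin> spectrum (cmat A) \<Longrightarrow>
      cmat \<Sigma> * (cmat (mat_inv K) * transfer_function A B C D s * cmat K)\<^sup>T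
      = cmat (mat_inv K) * transfer_function A B C D s * cmat K * cmat \<Sigma>"
    unfolding symmetrizable_def symmetric_on_def by auto
  define L where "L = mat_inv K"
  note inv = mat_inv_inverse[OF K(1) invertible_mat_det_nonzero[OF K], folded L_def]
  have \<Sigma>c: "\<Sigma> \<in> carrier_mat m m" using \<Sigma> by (simp add: signature_mat_def)
  define S where "S = K * \<Sigma> * K\<^sup>T"
  have S: "S \<in> carrier_mat m m" unfolding S_def using K \<Sigma>c by auto
  have KL: "K\<^sup>T * L\<^sup>T = 1\<^sub>m m" "L\<^sup>T * K\<^sup>T = 1\<^sub>m m"
    using inv K(1) by (simp_all add: transpose_mult[symmetric])
  have LS: "L * S = \<Sigma> * K\<^sup>T"
  proof -
    have "L * S = (L * K) * (\<Sigma> * K\<^sup>T)"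
      unfolding S_def using K(1) \<Sigma>c inv(1) by (simp add: assoc_mult_mat[of _ m m _ m _ m])
    thus ?thesis using inv \<Sigma>c K(1) by simp
  qed
  show ?thesis
  proof (rule that[OF S])
    show "S \<noteq> 0\<^sub>m m m"
    proof
      assume "S = 0\<^sub>m m m"
      hence "\<Sigma> * K\<^sup>T = 0\<^sub>m m m" using LS inv by simp
      hence "\<Sigma> * K\<^sup>T * L\<^sup>T = 0\<^sub>m m m" using inv by simp
      hence "\<Sigma> = 0\<^sub>m m m"
        using K(1) inv(1) \<Sigma>c by (simp add: assoc_mult_mat[of _ m m _ m _ m] KL)
      thus False using signature_mat_nonzero[OF \<Sigma> m] by simp
    qed
  next
    fix s assume s: "s \<notin> spectrum (cmat A)"
    define G where "G = transfer_function A B C D s"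
    have G: "G \<in> carrier_mat m m"
      unfolding G_def transfer_function_def using c by auto
    define k l e where "k = cmat K" and "l = cmat L" and "e = cmat \<Sigma>"
    have kle: "k \<in> carrier_mat m m" "l \<in> carrier_mat m m" "e \<in> carrier_mat m m"
      unfolding k_def l_def e_def using K inv \<Sigma>c by auto
    note as = assoc_mult_mat[of _ m m _ m _ m]
    have kl: "k * l = 1\<^sub>m m" unfolding k_def l_def
      using inv(1,2) K(1) by (simp add: of_real_hom.mat_hom_mult[symmetric] of_real_hom.mat_hom_one)
    hence kl': "l\<^sup>T * k\<^sup>T = 1\<^sub>m m" using kle by (simp add: transpose_mult[symmetric])
    have Se: "cmat S = k * e * k\<^sup>T"
      unfolding S_def k_def e_def using K(1) \<Sigma>c
      by (simp add: of_real_hom.mat_hom_mult[of _ m m _ m] map_mat_transpose)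
    have "e * (k\<^sup>T * (G\<^sup>T * l\<^sup>T)) = l * (G * (k * e))"
      using eq[OF s, folded L_def G_def, folded k_def l_def e_def] kle G
      by (simp add: transpose_mult[of _ m m _ m] as)
    hence "k * (e * (k\<^sup>T * (G\<^sup>T * l\<^sup>T))) * k\<^sup>T = k * (l * (G * (k * e))) * k\<^sup>T" by simp
    also have "k * (e * (k\<^sup>T * (G\<^sup>T * l\<^sup>T))) * k\<^sup>T = k * (e * (k\<^sup>T * (G\<^sup>T * (l\<^sup>T * k\<^sup>T))))"
      using kle G by (simp add: as)
    also have "\<dots> = cmat S * G\<^sup>T" unfolding kl' Se using kle G by (simp add: as)
    also have "k * (l * (G * (k * e))) * k\<^sup>T = (k * l) * (G * (k * (e * k\<^sup>T)))"
      using kle G by (simp add: as)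
    also have "\<dots> = G * cmat S" unfolding kl Se using kle G by (simp add: as)
    finally show "cmat S * G\<^sup>T = G * cmat S" .
  qed
qed

text \<open>
The transpose of the resolvent of \<open>A\<close> is the resolvent of \<open>A\<^sup>T\<close>, so both \<open>G S\<close> and \<open>S G\<^sup>T\<close>
have state space realizations and their expansions at infinity can be compared.
\<close>

lemma symmetrizer_markov:
  assumes c: "A \<in> carrier_mat n n" "B \<in> carrier_mat n m" "C \<in> carrier_mat m n" "D \<in> carrier_mat m m"
    and S: "S \<in> carrier_mat m m"
    and GS: "\<And>s. s \<notin> spectrum (cmat A) \<Longrightarrow>
      cmat S * (transfer_function A B C D s)\<^sup>T = transfer_function A B C D s * cmat S"
  shows "S * D\<^sup>T = D * S"
    and "C * (A ^\<^sub>m j * (B * S)) = S * B\<^sup>T * (A\<^sup>T ^\<^sub>m j * C\<^sup>T)"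
proof -
  define a b c d s where d: "a = cmat A" "b = cmat B" "c = cmat C" "d = cmat D" "s = cmat S"
  have ca: "a \<in> carrier_mat n n" "b \<in> carrier_mat n m" "c \<in> carrier_mat m n"
    "d \<in> carrier_mat m m" "s \<in> carrier_mat m m"
    unfolding d using assms by auto
  obtain R where R: "resolvent_seq n a R" "resolvent_seq n a\<^sup>T (\<lambda>k. (R k)\<^sup>T)"
    "\<forall>\<^sub>F k in sequentially. of_nat k \<notin> spectrum a \<and> R k = mat_inv (of_nat k \<cdot>\<^sub>m 1\<^sub>m n - a)"
    by (rule resolvent_seq_of_mat_inv[OF ca(1)])
  have Rk: "R k \<in> carrier_mat n n" for k using R(1) by (simp add: resolvent_seq_def)
  have eq: "\<forall>\<^sub>F k in sequentially. c * R k * (b * s) + d * s = s * b\<^sup>T * (R k)\<^sup>T * c\<^sup>T + s * d\<^sup>T"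
    using R(3)
  proof eventually_elim
    case (elim k)
    have tf: "transfer_function A B C D (of_nat k) = c * R k * b + d"
      using elim assms(1) unfolding transfer_function_def d by simp
    have "s * (c * R k * b + d)\<^sup>T = s * (b\<^sup>T * ((R k)\<^sup>T * c\<^sup>T) + d\<^sup>T)"
    proof -
      have cR: "c * R k \<in> carrier_mat m n" using ca Rk[of k] by auto
      hence "c * R k * b \<in> carrier_mat m m" using ca by auto
      thus ?thesis
        using transpose_add[of _ m m d] transpose_mult[OF cR ca(2)] transpose_mult[OF ca(3) Rk] ca by simp
    qed
    also have "\<dots> = s * (b\<^sup>T * ((R k)\<^sup>T * c\<^sup>T)) + s * d\<^sup>T"
      using ca Rk[of k] by (intro mult_add_distrib_mat[of _ m m]) auto
    also have "s * (b\<^sup>T * ((R k)\<^sup>T * c\<^sup>T)) = s * b\<^sup>T * (R k)\<^sup>T * c\<^sup>T"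
    proof -
      have "s * (b\<^sup>T * ((R k)\<^sup>T * c\<^sup>T)) = s * b\<^sup>T * ((R k)\<^sup>T * c\<^sup>T)"
        using ca Rk[of k] by (intro assoc_mult_mat[symmetric]) auto
      also have "\<dots> = s * b\<^sup>T * (R k)\<^sup>T * c\<^sup>T"
        using ca Rk[of k] by (intro assoc_mult_mat[symmetric]) auto
      finally show ?thesis .
    qed
    finally have 1: "s * (c * R k * b + d)\<^sup>T = s * b\<^sup>T * (R k)\<^sup>T * c\<^sup>T + s * d\<^sup>T" .
    have "(c * R k * b + d) * s = c * R k * b * s + d * s"
      using ca Rk[of k] by (intro add_mult_distrib_mat[of _ m m]) auto
    also have "c * R k * b * s = c * R k * (b * s)"
      using ca Rk[of k] by (intro assoc_mult_mat) auto
    finally show ?case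
      using 1 GS[of "of_nat k"] elim tf unfolding d(1,5) by simp
  qed
  have bs: "b * s \<in> carrier_mat n m" "c\<^sup>T \<in> carrier_mat n m" "s * b\<^sup>T \<in> carrier_mat m n"
    "d * s \<in> carrier_mat m m" "s * d\<^sup>T \<in> carrier_mat m m" using ca by auto
  have "d * s = s * d\<^sup>T"
    by (rule feedthrough_unique[OF R(1,2) ca(3) bs(1,4,3,2,5) eq])
  hence "cmat (S * D\<^sup>T) = cmat (D * S)"
    using assms(4) S by (simp add: d of_real_hom.mat_hom_mult[of _ m m _ m] map_mat_transpose)
  thus "S * D\<^sup>T = D * S" by (rule of_real_hom.mat_hom_inj)
  have "c * (a ^\<^sub>m j * (b * s)) = s * b\<^sup>T * (a\<^sup>T ^\<^sub>m j * c\<^sup>T)"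
    by (rule markov_parameters_unique[OF R(1,2) bs(1,2) ca(3) bs(3,4,5) eq])
  moreover have "cmat (X * (M ^\<^sub>m j * Y)) = cmat X * (cmat M ^\<^sub>m j * cmat Y)"
    if "X \<in> carrier_mat m n" "M \<in> carrier_mat n n" "Y \<in> carrier_mat n m" for X M Y :: "real mat"
  proof -
    have Mj: "M ^\<^sub>m j \<in> carrier_mat n n" using that by (intro pow_carrier_mat)
    show ?thesis
      by (simp add: of_real_hom.mat_hom_mult[OF that(1) mult_carrier_mat[OF Mj that(3)]]
          of_real_hom.mat_hom_mult[OF Mj that(3)] of_real_hom.mat_hom_pow[OF that(2)])
  qed
  moreover have "cmat (B * S) = b * s" "cmat (S * B\<^sup>T) = s * b\<^sup>T" "cmat C\<^sup>T = c\<^sup>T" "cmat A\<^sup>T = a\<^sup>T"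
    using assms(2) S by (simp_all add: d of_real_hom.mat_hom_mult[of _ n m _ m]
      of_real_hom.mat_hom_mult[of _ m m _ n] map_mat_transpose)
  ultimately have "cmat (C * (A ^\<^sub>m j * (B * S))) = cmat (S * B\<^sup>T * (A\<^sup>T ^\<^sub>m j * C\<^sup>T))"
    using assms(1-4) S d by simp
  thus "C * (A ^\<^sub>m j * (B * S)) = S * B\<^sup>T * (A\<^sup>T ^\<^sub>m j * C\<^sup>T)" by (rule of_real_hom.mat_hom_inj)
qed

section \<open>Lifting a symmetrizer to the state space\<close>

lemma pow_mat_add_mult:
  assumes A: "A \<in> carrier_mat n n"
  shows "A ^\<^sub>m i * A ^\<^sub>m j = A ^\<^sub>m (i + j)"
proof (induction j)
  case (Suc j)
  have "A ^\<^sub>m i * A ^\<^sub>m Suc j = (A ^\<^sub>m i * A ^\<^sub>m j) * A"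
    using A pow_carrier_mat[OF A, of i] pow_carrier_mat[OF A, of j]
    by (simp add: assoc_mult_mat[of _ n n _ n _ n])
  with Suc show ?case by simp
qed (use A pow_carrier_mat[OF A, of i] in simp)

lemma transpose_pow_mat:
  fixes A :: "'a::comm_semiring_1 mat"
  assumes A: "A \<in> carrier_mat n n"
  shows "(A ^\<^sub>m j)\<^sup>T = A\<^sup>T ^\<^sub>m j"
proof (induction j)
  case (Suc j)
  have "(A ^\<^sub>m Suc j)\<^sup>T = A\<^sup>T * A\<^sup>T ^\<^sub>m j"
    using A pow_carrier_mat[OF A, of j] Suc by (simp add: transpose_mult[of _ n n _ n])
  also have "\<dots> = A\<^sup>T ^\<^sub>m Suc j" using pow_mat_commute[of "A\<^sup>T" n j] A by simp
  finally show ?case .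
qed (use A in simp)

lemma observability_mat_carrier:
  assumes "A \<in> carrier_mat n n" "C \<in> carrier_mat m n"
  shows "observability_mat A C \<in> carrier_mat (n * m) n"
  using assms by (auto simp: observability_mat_def)

lemma controllability_mat_carrier:
  assumes "A \<in> carrier_mat n n" "B \<in> carrier_mat n m"
  shows "controllability_mat A B \<in> carrier_mat n (n * m)"
  using assms by (auto simp: controllability_mat_def)

lemma transpose_observability_mat:
  fixes A C :: "'a::field mat"
  assumes A: "A \<in> carrier_mat n n" and C: "C \<in> carrier_mat m n"
  shows "(observability_mat A C)\<^sup>T = controllability_mat A\<^sup>T C\<^sup>T"
proof (rule eq_matI)
  fix i j
  assume ij: "i < dim_row (controllability_mat A\<^sup>T C\<^sup>T)" "j < dim_col (controllability_mat A\<^sup>T C\<^sup>T)"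
  hence ij: "i < n" "j < n * m" using A C by (auto simp: controllability_mat_def)
  hence jm: "j mod m < m" by (cases m) auto
  have Ap: "A ^\<^sub>m k \<in> carrier_mat n n" for k using A by (rule pow_carrier_mat)
  have "A\<^sup>T ^\<^sub>m (j div m) * C\<^sup>T = (C * A ^\<^sub>m (j div m))\<^sup>T"
    using transpose_mult[OF C Ap] transpose_pow_mat[OF A] by simp
  thus "(observability_mat A C)\<^sup>T $$ (i, j) = controllability_mat A\<^sup>T C\<^sup>T $$ (i, j)"
    using A C Ap[of "j div m"] ij jm
    by (simp add: observability_mat_def controllability_mat_def del: index_mult_mat(1))
qed (use A C in \<open>auto simp: observability_mat_def controllability_mat_def\<close>)

text \<open>
Products of this form are block Hankel matrices when \<open>M\<close> is a power of \<open>A\<close> and \<open>A' = A\<close>: the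
block in position \<open>(a, b)\<close> is then a Markov parameter.
\<close>

lemma observability_mult_controllability_entry:
  fixes A A' C B M :: "'a::field mat"
  assumes A: "A \<in> carrier_mat n n" "A' \<in> carrier_mat n n" and C: "C \<in> carrier_mat m n"
    and B: "B \<in> carrier_mat n m" and M: "M \<in> carrier_mat n n"
    and ij: "i < n * m" "j < n * m"
  shows "(observability_mat A C * M * controllability_mat A' B) $$ (i, j) =
    (C * A ^\<^sub>m (i div m) * M * (A' ^\<^sub>m (j div m) * B)) $$ (i mod m, j mod m)"
proof -
  have Ap: "A ^\<^sub>m k \<in> carrier_mat n n" "A' ^\<^sub>m k \<in> carrier_mat n n" for k
    using A by (auto intro: pow_carrier_mat)
  have m: "i mod m < m" "j mod m < m" using ij by (cases m; auto)+
  note O = observability_mat_carrier[OF A(1) C] and R = controllability_mat_carrier[OF A(2) B]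
  have O': "C * A ^\<^sub>m (i div m) \<in> carrier_mat m n" using C Ap[of "i div m"] by auto
  have R': "A' ^\<^sub>m (j div m) * B \<in> carrier_mat n m" using B Ap[of "j div m"] by auto
  have "(observability_mat A C * M * controllability_mat A' B) $$ (i, j) =
    (\<Sum>b<n. (\<Sum>a<n. observability_mat A C $$ (i, a) * M $$ (a, b)) * controllability_mat A' B $$ (b, j))"
    using mat_mult_entry[OF mult_carrier_mat[OF O M] R ij] mat_mult_entry[OF O M ij(1)] by simp
  also have "\<dots> = (\<Sum>b<n. (\<Sum>a<n. (C * A ^\<^sub>m (i div m)) $$ (i mod m, a) * M $$ (a, b)) *
      (A' ^\<^sub>m (j div m) * B) $$ (b, j mod m))"
    using ij A B C by (simp add: observability_mat_def controllability_mat_def)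
  also have "\<dots> = (C * A ^\<^sub>m (i div m) * M * (A' ^\<^sub>m (j div m) * B)) $$ (i mod m, j mod m)"
    using mat_mult_entry[OF mult_carrier_mat[OF O' M] R' m] mat_mult_entry[OF O' M m(1)] by simp
  finally show ?thesis .
qed

text \<open>
Over the reals, \<open>M v\<close> and \<open>M\<^sup>T M v\<close> vanish together because \<open>v\<^sup>T M\<^sup>T M v\<close> is a sum of squares.
Hence the Gram matrix is invertible and \<open>inv(M\<^sup>T M) M\<^sup>T\<close> is a left inverse.
\<close>

lemma full_column_rank_left_inverse:
  fixes M :: "real mat"
  assumes M: "M \<in> carrier_mat nr nc" and rank: "mat_rank M = nc"
  obtains L where "L \<in> carrier_mat nc nr" "L * M = 1\<^sub>m nc"
proof -
  have G: "M\<^sup>T * M \<in> carrier_mat nc nc" using M by auto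
  have "det (M\<^sup>T * M) \<noteq> 0"
  proof
    assume "det (M\<^sup>T * M) = 0"
    then obtain v where v: "v \<in> carrier_vec nc" "v \<noteq> 0\<^sub>v nc" "(M\<^sup>T * M) *\<^sub>v v = 0\<^sub>v nc"
      using det_0_iff_vec_prod_zero_field[OF G] by auto
    have Mv: "M *\<^sub>v v \<in> carrier_vec nr" using M v by auto
    have "(M *\<^sub>v v) \<bullet> (M *\<^sub>v v) = (M\<^sup>T *\<^sub>v (M *\<^sub>v v)) \<bullet> v"
      using transpose_vec_mult_scalar[OF M v(1) Mv] by simp
    also have "M\<^sup>T *\<^sub>v (M *\<^sub>v v) = 0\<^sub>v nc"
      using v M by (subst assoc_mult_mat_vec[symmetric, of _ nc nr _ nc]) auto
    finally have "(\<Sum>i = 0..<nr. (M *\<^sub>v v) $ i * (M *\<^sub>v v) $ i) = 0"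
      using v(1) M by (simp add: scalar_prod_def[of "M *\<^sub>v v"])
    hence "\<forall>i<nr. (M *\<^sub>v v) $ i = 0" by (subst (asm) sum_nonneg_eq_0_iff) auto
    hence "M *\<^sub>v v = 0\<^sub>v nr" using M by (intro eq_vecI) auto
    from rank_less_if_kernel_nontrivial[OF M v(1,2) this] rank show False by simp
  qed
  note i = mat_inv_inverse[OF G this]
  show ?thesis
  proof (rule that[of "mat_inv (M\<^sup>T * M) * M\<^sup>T"])
    show "mat_inv (M\<^sup>T * M) * M\<^sup>T \<in> carrier_mat nc nr" using i M by auto
    have "mat_inv (M\<^sup>T * M) * M\<^sup>T * M = mat_inv (M\<^sup>T * M) * (M\<^sup>T * M)"
      using i M by (intro assoc_mult_mat) auto
    thus "mat_inv (M\<^sup>T * M) * M\<^sup>T * M = 1\<^sub>m nc" using i by simp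
  qed
qed

text \<open>
Let \<open>O1, R1\<close> be the observability and controllability matrices of \<open>(A, B S, C)\<close> and \<open>O2, R2\<close>
those of \<open>(A\<^sup>T, C\<^sup>T, S B\<^sup>T)\<close>. Equality of the Markov parameters says
\<open>O1 A\<^sup>k R1 = O2 (A\<^sup>T)\<^sup>k R2\<close>. Since \<open>R2 = O1\<^sup>T\<close>, observability of \<open>(A, C)\<close> makes \<open>O1\<close> left and
\<open>R2\<close> right cancellable. So \<open>O1 T = O2\<close> and \<open>T R2 = R1\<close> for one matrix \<open>T\<close>; the case \<open>k = 1\<close>
gives \<open>A T = T A\<^sup>T\<close>, and the first blocks of \<open>O1 T = O2\<close> and \<open>T R2 = R1\<close> give the other two
equations.
\<close>

lemma observable_symmetrizer_extends:
  fixes A B C S :: "real mat"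
  assumes A: "A \<in> carrier_mat n n" and B: "B \<in> carrier_mat n m" and C: "C \<in> carrier_mat m n"
    and S: "S \<in> carrier_mat m m" and obs: "observable A C"
    and markov: "\<And>j. C * (A ^\<^sub>m j * (B * S)) = S * B\<^sup>T * (A\<^sup>T ^\<^sub>m j * C\<^sup>T)"
  obtains T where "T \<in> carrier_mat n n" "A * T = T * A\<^sup>T" "B * S = T * C\<^sup>T" "C * T = S * B\<^sup>T"
proof -
  define O1 where "O1 = observability_mat A C"
  define O2 where "O2 = observability_mat A\<^sup>T (S * B\<^sup>T)"
  define R1 where "R1 = controllability_mat A (B * S)"
  define R2 where "R2 = controllability_mat A\<^sup>T C\<^sup>T"
  have At: "A\<^sup>T \<in> carrier_mat n n" and BS: "B * S \<in> carrier_mat n m"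
    and Ct: "C\<^sup>T \<in> carrier_mat n m" and SB: "S * B\<^sup>T \<in> carrier_mat m n"
    using A B C S by auto
  have O1: "O1 \<in> carrier_mat (n * m) n" and O2: "O2 \<in> carrier_mat (n * m) n"
    and R1: "R1 \<in> carrier_mat n (n * m)" and R2: "R2 \<in> carrier_mat n (n * m)"
    unfolding O1_def O2_def R1_def R2_def
    by (rule observability_mat_carrier controllability_mat_carrier; rule A At BS Ct SB C)+
  have O1_R2: "O1\<^sup>T = R2" unfolding O1_def R2_def by (rule transpose_observability_mat[OF A C])
  have Ap: "A ^\<^sub>m k \<in> carrier_mat n n" "A\<^sup>T ^\<^sub>m k \<in> carrier_mat n n" for k
    using A by (auto intro: pow_carrier_mat)
  have "mat_rank O1 = n" using obs A unfolding observable_def O1_def by simp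
  then obtain L where L: "L \<in> carrier_mat n (n * m)" "L * O1 = 1\<^sub>m n"
    using full_column_rank_left_inverse[OF O1] by blast
  have L': "R2 * L\<^sup>T = 1\<^sub>m n"
    using arg_cong[OF L(2), of transpose_mat] transpose_mult[OF L(1) O1] O1_R2 by simp
  have cancel_left: "M = N" if "M \<in> carrier_mat n k" "N \<in> carrier_mat n k" "O1 * M = O1 * N" for M N k
  proof -
    have "L * O1 * M = L * O1 * N"
      using that(3) assoc_mult_mat[OF L(1) O1 that(1)] assoc_mult_mat[OF L(1) O1 that(2)] by simp
    thus ?thesis using that(1,2) unfolding L(2) by simp
  qed
  have cancel_right: "M = N" if "M \<in> carrier_mat k n" "N \<in> carrier_mat k n" "M * R2 = N * R2" for M N k
  proof -
    have "L\<^sup>T \<in> carrier_mat (n * m) n" using L by simp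
    hence "M * (R2 * L\<^sup>T) = N * (R2 * L\<^sup>T)"
      using that(3) assoc_mult_mat[OF that(1) R2] assoc_mult_mat[OF that(2) R2] by metis
    thus ?thesis using that(1,2) unfolding L' by simp
  qed
  \<comment> \<open>In block position \<open>(a, b)\<close> both sides are Markov parameters with exponent \<open>a + k + b\<close>.\<close>
  have hankel: "O1 * A ^\<^sub>m k * R1 = O2 * A\<^sup>T ^\<^sub>m k * R2" for k
  proof (rule eq_matI)
    fix i j assume "i < dim_row (O2 * A\<^sup>T ^\<^sub>m k * R2)" "j < dim_col (O2 * A\<^sup>T ^\<^sub>m k * R2)"
    hence ij: "i < n * m" "j < n * m" using O2 R2 by auto
    have eq: "X * M ^\<^sub>m a * M ^\<^sub>m k * (M ^\<^sub>m b * Y) = X * (M ^\<^sub>m (a + k + b) * Y)"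
      if "X \<in> carrier_mat m n" "M \<in> carrier_mat n n" "Y \<in> carrier_mat n m"
      for X M Y :: "real mat" and a b
    proof -
      have Mp: "M ^\<^sub>m c \<in> carrier_mat n n" for c using that by (intro pow_carrier_mat)
      have "X * M ^\<^sub>m a * M ^\<^sub>m k = X * M ^\<^sub>m (a + k)"
        using that(1) Mp[of a] Mp[of k] pow_mat_add_mult[OF that(2)]
        by (simp add: assoc_mult_mat[of _ m n _ n _ n])
      moreover have "X * M ^\<^sub>m (a + k) * (M ^\<^sub>m b * Y) = X * (M ^\<^sub>m (a + k) * (M ^\<^sub>m b * Y))"
        using that Mp[of "a + k"] Mp[of b] by (intro assoc_mult_mat) auto
      moreover have "M ^\<^sub>m (a + k) * (M ^\<^sub>m b * Y) = M ^\<^sub>m (a + k) * M ^\<^sub>m b * Y"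
        using that Mp[of "a + k"] Mp[of b] by (intro assoc_mult_mat[symmetric]) auto
      ultimately show ?thesis using pow_mat_add_mult[OF that(2)] by simp
    qed
    show "(O1 * A ^\<^sub>m k * R1) $$ (i, j) = (O2 * A\<^sup>T ^\<^sub>m k * R2) $$ (i, j)"
      unfolding O1_def O2_def R1_def R2_def
        observability_mult_controllability_entry[OF A A C BS Ap(1) ij]
        observability_mult_controllability_entry[OF At At SB Ct Ap(2) ij]
        eq[OF C A BS] eq[OF SB At Ct] markov ..
  qed (use O1 O2 R1 R2 in auto)
  have O1R1: "O1 * R1 = O2 * R2" using hankel[of 0] A O1 O2 by simp
  \<comment> \<open>\<open>L\<^sup>T\<close> is a right inverse of \<open>R2\<close>, so this is the only candidate for \<open>T R2 = R1\<close>.\<close>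
  define T where "T = R1 * L\<^sup>T"
  have T: "T \<in> carrier_mat n n" unfolding T_def using R1 L by auto
  have O1T: "O1 * T = O2"
  proof -
    have "O1 * T = O1 * R1 * L\<^sup>T" unfolding T_def using O1 R1 L by (intro assoc_mult_mat[symmetric]) auto
    also have "\<dots> = O2 * (R2 * L\<^sup>T)" unfolding O1R1 using O2 R2 L by (intro assoc_mult_mat) auto
    finally show ?thesis using L' O2 by simp
  qed
  have TR2: "T * R2 = R1"
  proof (rule cancel_left)
    show "O1 * (T * R2) = O1 * R1"
      unfolding O1R1 O1T[symmetric] using O1 T R2 by (intro assoc_mult_mat[symmetric]) auto
  qed (use T R1 R2 in auto)
  have AT: "A * T = T * A\<^sup>T"
  proof (rule cancel_left[OF _ _ cancel_right])
    have "O1 * (A * T) * R2 = O1 * A * R1"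
      unfolding TR2[symmetric] using O1 A T R2
      by (simp add: assoc_mult_mat[of _ "n * m" n _ n _ n] assoc_mult_mat[of _ "n * m" n _ n _ "n * m"]
        assoc_mult_mat[of _ n n _ n _ "n * m"])
    also have "\<dots> = O2 * A\<^sup>T * R2" using hankel[of 1] A by simp
    also have "\<dots> = O1 * (T * A\<^sup>T) * R2"
      unfolding O1T[symmetric] using O1 At T by (simp add: assoc_mult_mat[of _ "n * m" n _ n _ n])
    finally show "O1 * (A * T) * R2 = O1 * (T * A\<^sup>T) * R2" .
  qed (use O1 A At T in auto)
  have CT: "C * T = S * B\<^sup>T"
  proof (rule eq_matI)
    fix i j assume "i < dim_row (S * B\<^sup>T)" "j < dim_col (S * B\<^sup>T)"
    hence ij: "i < m" "j < n" using S B by auto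
    hence im: "i < n * m" by (cases n) auto
    \<comment> \<open>The first \<open>m\<close> rows of \<open>O1\<close> are those of \<open>C\<close>; they exist as soon as there
      is an entry to compare, since then \<open>0 < n\<close>.\<close>
    have "(C * T) $$ (i, j) = (O1 * T) $$ (i, j)"
      using mat_mult_entry[OF C T ij] mat_mult_entry[OF O1 T im ij(2)] A C im ij
      by (simp add: O1_def observability_mat_def)
    also have "\<dots> = (S * B\<^sup>T) $$ (i, j)"
      unfolding O1T using A S B im ij by (simp add: O2_def observability_mat_def del: index_mult_mat(1))
    finally show "(C * T) $$ (i, j) = (S * B\<^sup>T) $$ (i, j)" .
  qed (use C T S B in auto)
  have TC: "B * S = T * C\<^sup>T"
  proof (rule eq_matI)
    fix i j assume "i < dim_row (T * C\<^sup>T)" "j < dim_col (T * C\<^sup>T)"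
    hence ij: "i < n" "j < m" using T C by auto
    hence jm: "j < n * m" by (cases n) auto
    have "(T * C\<^sup>T) $$ (i, j) = (T * R2) $$ (i, j)"
      using mat_mult_entry[OF T Ct ij] mat_mult_entry[OF T R2 ij(1) jm] A C jm ij
      by (simp add: R2_def controllability_mat_def)
    also have "\<dots> = (B * S) $$ (i, j)"
      unfolding TR2 using A S B jm ij by (simp add: R1_def controllability_mat_def del: index_mult_mat(1))
    finally show "(B * S) $$ (i, j) = (T * C\<^sup>T) $$ (i, j)" ..
  qed (use C T S B in auto)
  show ?thesis by (rule that[OF T AT TC CT])
qed

section \<open>Block-diagonal relations and the Khatri-Rao product\<close>

abbreviation block_offset :: "nat list \<Rightarrow> nat \<Rightarrow> nat" where
  "block_offset ts j \<equiv> sum_list (take j ts)"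

lemma block_index_exhaust:
  assumes "a < sum_list ts"
  obtains j k where "j < length ts" "k < ts ! j" "a = block_offset ts j + k"
proof -
  have "\<exists>j k. j < length ts \<and> k < ts ! j \<and> a = block_offset ts j + k"
    using assms
  proof (induction ts arbitrary: a)
    case (Cons t ts)
    show ?case
    proof (cases "a < t")
      case True
      thus ?thesis by (intro exI[of _ 0] exI[of _ a]) auto
    next
      case False
      hence "a - t < sum_list ts" using Cons.prems by simp
      from Cons.IH[OF this] obtain j k where
        "j < length ts" "k < ts ! j" "a - t = block_offset ts j + k" by blast
      thus ?thesis using False by (intro exI[of _ "Suc j"] exI[of _ k]) auto
    qed
  qed simp
  thus ?thesis using that by blast
qed

lemma block_index_less:
  "j < length ts \<Longrightarrow> k < ts ! j \<Longrightarrow> block_offset ts j + k < sum_list ts"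
proof (induction ts arbitrary: j)
  case (Cons t ts)
  thus ?case by (cases j) fastforce+
qed simp

lemma sum_over_blocks:
  fixes f :: "nat \<Rightarrow> 'a::comm_monoid_add"
  shows "(\<Sum>a<sum_list ts. f a) = (\<Sum>j<length ts. \<Sum>k<ts ! j. f (block_offset ts j + k))"
proof (induction ts arbitrary: f)
  case (Cons t ts)
  have split: "(\<Sum>a<t + s. f a) = (\<Sum>a<t. f a) + (\<Sum>a<s. f (t + a))" for s
    by (induction s) (auto simp: add.assoc)
  show ?case
    by (simp add: split Cons.IH[of "\<lambda>a. f (t + a)"] sum.lessThan_Suc_shift add.assoc del: sum.lessThan_Suc)
qed simp

lemma diag_block_mat_entry:
  assumes "length Js = length ts"
    and "\<And>i. i < length ts \<Longrightarrow> Js ! i \<in> carrier_mat (ts ! i) (ts ! i)"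
    and "i < length ts" "j < length ts" "k < ts ! i" "l < ts ! j"
  shows "diag_block_mat Js $$ (block_offset ts i + k, block_offset ts j + l) =
    (if i = j then Js ! i $$ (k, l) else 0)"
  using assms
proof (induction Js arbitrary: ts i j)
  case (Cons J Js)
  then obtain t us where ts: "ts = t # us" by (cases ts) auto
  have J: "J \<in> carrier_mat t t" using Cons.prems(2)[of 0] ts by simp
  have Js: "Js ! i \<in> carrier_mat (us ! i) (us ! i)" if "i < length us" for i
    using Cons.prems(2)[of "Suc i"] that ts by simp
  have len: "length Js = length us" using Cons.prems ts by simp
  have dims: "map dim_row Js = us" "map dim_col Js = us"
    using carrier_matD[OF Js] len by (auto intro!: nth_equalityI)
  have D: "diag_block_mat Js \<in> carrier_mat (sum_list us) (sum_list us)"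
    by (intro carrier_matI) (simp_all add: dim_diag_block_mat dims)
  have off: "block_offset us a + b < sum_list us" if "ts ! Suc a > b" "Suc a < length ts" for a b
    using block_index_less[of a us b] that ts by simp
  have IH: "diag_block_mat Js $$ (block_offset us i' + k, block_offset us j' + l) =
    (if i' = j' then Js ! i' $$ (k, l) else 0)" if "i = Suc i'" "j = Suc j'" for i' j'
    using Cons.IH[OF len Js, of i' j'] Cons.prems that ts by simp
  show ?case
    using Cons.prems(3-) J D off
    by (cases i; cases j) (auto simp: ts Let_def IH dest: off)
qed simp

definition mat_block :: "nat list \<Rightarrow> 'a mat \<Rightarrow> nat \<Rightarrow> nat \<Rightarrow> 'a mat" where
  "mat_block ts Y i j =
     mat (ts ! i) (ts ! j) (\<lambda>(k, l). Y $$ (block_offset ts i + k, block_offset ts j + l))"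

lemma mat_block_diag_mult:
  fixes Y :: "real mat"
  assumes len: "length Js = length ts"
    and Js: "\<And>i. i < length ts \<Longrightarrow> Js ! i \<in> carrier_mat (ts ! i) (ts ! i)"
    and Y: "Y \<in> carrier_mat (sum_list ts) (sum_list ts)"
    and ij: "i < length ts" "j < length ts"
  shows "mat_block ts (diag_block_mat Js * Y) i j = Js ! i * mat_block ts Y i j"
    and "mat_block ts (Y * (diag_block_mat Js)\<^sup>T) i j = mat_block ts Y i j * (Js ! j)\<^sup>T"
proof -
  let ?o = "block_offset ts"
  have "map dim_row Js = ts" "map dim_col Js = ts"
    using carrier_matD[OF Js] len by (auto intro!: nth_equalityI)
  hence J: "diag_block_mat Js \<in> carrier_mat (sum_list ts) (sum_list ts)"
    by (intro carrier_matI) (simp_all add: dim_diag_block_mat)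
  note entry = diag_block_mat_entry[OF len Js]
  have M: "mat_block ts Y i j \<in> carrier_mat (ts ! i) (ts ! j)" by (simp add: mat_block_def)
  show "mat_block ts (diag_block_mat Js * Y) i j = Js ! i * mat_block ts Y i j"
  proof (rule eq_matI)
    fix k l assume "k < dim_row (Js ! i * mat_block ts Y i j)" "l < dim_col (Js ! i * mat_block ts Y i j)"
    hence kl: "k < ts ! i" "l < ts ! j" using Js[OF ij(1)] by (auto simp: mat_block_def)
    have "(diag_block_mat Js * Y) $$ (?o i + k, ?o j + l) =
      (\<Sum>a<length ts. \<Sum>b<ts ! a. diag_block_mat Js $$ (?o i + k, ?o a + b) * Y $$ (?o a + b, ?o j + l))"
      using block_index_less[OF ij(1) kl(1)] block_index_less[OF ij(2) kl(2)]
      by (simp add: mat_mult_entry[OF J Y] sum_over_blocks)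
    also have "\<dots> = (\<Sum>a<length ts. if i = a
      then (\<Sum>b<ts ! i. Js ! i $$ (k, b) * Y $$ (?o i + b, ?o j + l)) else 0)"
      using ij kl by (intro sum.cong) (auto simp: entry)
    also have "\<dots> = (Js ! i * mat_block ts Y i j) $$ (k, l)"
      unfolding mat_mult_entry[OF Js[OF ij(1)] M kl] using ij kl by (simp add: mat_block_def)
    finally show "mat_block ts (diag_block_mat Js * Y) i j $$ (k, l) = (Js ! i * mat_block ts Y i j) $$ (k, l)"
      using kl by (simp add: mat_block_def)
  qed (use Js[OF ij(1)] in \<open>auto simp: mat_block_def\<close>)
  have Jt: "(diag_block_mat Js)\<^sup>T \<in> carrier_mat (sum_list ts) (sum_list ts)"
    "(Js ! j)\<^sup>T \<in> carrier_mat (ts ! j) (ts ! j)" using J Js[OF ij(2)] by auto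
  show "mat_block ts (Y * (diag_block_mat Js)\<^sup>T) i j = mat_block ts Y i j * (Js ! j)\<^sup>T"
  proof (rule eq_matI)
    fix k l assume "k < dim_row (mat_block ts Y i j * (Js ! j)\<^sup>T)" "l < dim_col (mat_block ts Y i j * (Js ! j)\<^sup>T)"
    hence kl: "k < ts ! i" "l < ts ! j" using Js[OF ij(2)] by (auto simp: mat_block_def)
    have "(Y * (diag_block_mat Js)\<^sup>T) $$ (?o i + k, ?o j + l) =
      (\<Sum>a<length ts. \<Sum>b<ts ! a. Y $$ (?o i + k, ?o a + b) * diag_block_mat Js $$ (?o j + l, ?o a + b))"
      using block_index_less[OF ij(1) kl(1)] block_index_less[OF ij(2) kl(2)] block_index_less J
      by (simp add: mat_mult_entry[OF Y Jt(1)] sum_over_blocks)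
    also have "\<dots> = (\<Sum>a<length ts. if j = a
      then (\<Sum>b<ts ! j. Y $$ (?o i + k, ?o j + b) * Js ! j $$ (l, b)) else 0)"
      using ij kl by (intro sum.cong) (auto simp: entry)
    also have "\<dots> = (mat_block ts Y i j * (Js ! j)\<^sup>T) $$ (k, l)"
      unfolding mat_mult_entry[OF M Jt(2) kl] using ij kl Js[OF ij(2)] by (simp add: mat_block_def)
    finally show "mat_block ts (Y * (diag_block_mat Js)\<^sup>T) i j $$ (k, l) = (mat_block ts Y i j * (Js ! j)\<^sup>T) $$ (k, l)"
      using kl by (simp add: mat_block_def)
  qed (use Js[OF ij(2)] in \<open>auto simp: mat_block_def\<close>)
qed

lemma spectrum_transpose:
  fixes A :: "complex mat"
  assumes A: "A \<in> carrier_mat n n"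
  shows "spectrum A\<^sup>T = spectrum A"
  using A spectrum_root_char_poly[of "A\<^sup>T" n] spectrum_root_char_poly[OF A] by simp

text \<open>
The block \<open>Y\<^sub>i\<^sub>j\<close> satisfies \<open>J\<^sub>i Y\<^sub>i\<^sub>j = Y\<^sub>i\<^sub>j J\<^sub>j\<^sup>T\<close>, a Sylvester equation without common
eigenvalues.
\<close>

lemma symmetrizer_block_diagonal:
  fixes Y :: "real mat"
  assumes len: "length Js = length ts"
    and Js: "\<And>i. i < length ts \<Longrightarrow> Js ! i \<in> carrier_mat (ts ! i) (ts ! i)"
    and disj: "\<And>i j. i < length ts \<Longrightarrow> j < length ts \<Longrightarrow> i \<noteq> j \<Longrightarrow>
      spectrum (cmat (Js ! i)) \<inter> spectrum (cmat (Js ! j)) = {}"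
    and Y: "Y \<in> carrier_mat (sum_list ts) (sum_list ts)"
    and JY: "diag_block_mat Js * Y = Y * (diag_block_mat Js)\<^sup>T"
    and ij: "i < length ts" "j < length ts" "i \<noteq> j" and kl: "k < ts ! i" "l < ts ! j"
  shows "Y $$ (block_offset ts i + k, block_offset ts j + l) = 0"
proof -
  let ?Y = "mat_block ts Y i j"
  have M: "?Y \<in> carrier_mat (ts ! i) (ts ! j)" by (simp add: mat_block_def)
  have eq: "Js ! i * ?Y = ?Y * (Js ! j)\<^sup>T"
    using mat_block_diag_mult[OF len Js Y ij(1,2)] JY by simp
  have "cmat ?Y = 0\<^sub>m (ts ! i) (ts ! j)"
  proof (rule sylvester_only_zero_solution)
    show "cmat (Js ! i) * cmat ?Y = cmat ?Y * (cmat (Js ! j))\<^sup>T"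
      using arg_cong[OF eq, of cmat] Js[OF ij(1)] Js[OF ij(2)] M
      by (simp add: of_real_hom.mat_hom_mult[of _ "ts ! i" "ts ! i" _ "ts ! j"]
        of_real_hom.mat_hom_mult[of _ "ts ! i" "ts ! j" _ "ts ! j"] map_mat_transpose)
    show "spectrum (cmat (Js ! i)) \<inter> spectrum (cmat (Js ! j))\<^sup>T = {}"
      using disj[OF ij] spectrum_transpose[of "cmat (Js ! j)" "ts ! j"] Js[OF ij(2)] by simp
  qed (use Js[OF ij(1)] Js[OF ij(2)] M in auto)
  hence "cmat ?Y $$ (k, l) = 0" using kl by simp
  thus ?thesis using kl by (simp add: mat_block_def)
qed

text \<open>
The vectorizations of the diagonal blocks of \<open>Y\<close>, one after the other. Column \<open>c\<close> of
\<open>Z\<^sub>j \<otimes> W\<^sub>j\<close> pairs column \<open>c div t\<^sub>j\<close> of \<open>Z\<^sub>j\<close> with column \<open>c mod t\<^sub>j\<close> of \<open>W\<^sub>j\<close>; in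
\<open>W\<^sub>j Y\<^sub>j Z\<^sub>j\<^sup>T\<close> this pair carries the coefficient in row \<open>c mod t\<^sub>j\<close> and column \<open>c div t\<^sub>j\<close> of
\<open>Y\<^sub>j\<close>.
\<close>

definition block_coeffs :: "nat list \<Rightarrow> 'a mat \<Rightarrow> 'a list" where
  "block_coeffs ts Y = concat (map (\<lambda>j.
     map (\<lambda>c. Y $$ (block_offset ts j + c mod ts ! j, block_offset ts j + c div ts ! j))
       [0..<ts ! j * ts ! j]) [0..<length ts])"

lemma set_block_coeffs:
  "set (block_coeffs ts Y) = (\<Union>j<length ts.
     (\<lambda>c. Y $$ (block_offset ts j + c mod ts ! j, block_offset ts j + c div ts ! j)) ` {..<ts ! j * ts ! j})"
  by (simp add: block_coeffs_def atLeast0LessThan)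

lemma length_block_coeffs: "length (block_coeffs ts Y) = (\<Sum>j<length ts. (ts ! j)\<^sup>2)"
  by (simp add: block_coeffs_def length_concat o_def interv_sum_list_conv_sum_set_nat
      power2_eq_square atLeast0LessThan)

text \<open>
This is the blockwise form of the identity \<open>(Z \<otimes> W) vec(Y) = vec(W Y Z\<^sup>T)\<close>.
\<close>

lemma khatri_rao_mult_block_coeffs:
  fixes Y :: "'a::field mat"
  assumes Z: "Z \<in> carrier_mat m N" and W: "W \<in> carrier_mat n N" and x: "x < m * n"
  shows "(khatri_rao ts Z W *\<^sub>v vec_of_list (block_coeffs ts Y)) $ x =
    (\<Sum>j<length ts. \<Sum>l<ts ! j. \<Sum>k<ts ! j.
       Z $$ (x div n, block_offset ts j + l) * W $$ (x mod n, block_offset ts j + k)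
       * Y $$ (block_offset ts j + k, block_offset ts j + l))"
proof -
  define f where "f = (\<lambda>j. cols (kronecker (col_block ts Z j) (col_block ts W j)))"
  define g where "g = (\<lambda>j. map (\<lambda>c. Y $$ (block_offset ts j + c mod ts ! j, block_offset ts j + c div ts ! j))
       [0..<ts ! j * ts ! j])"
  define h where "h = (\<lambda>v (c :: 'a). v $ x * c)"
  have len: "length (f j) = length (g j)" for j
    by (simp add: f_def g_def kronecker_def col_block_def)
  have lenc: "length (concat (map f js)) = length (concat (map g js))" for js
    by (simp add: length_concat o_def len)
  have "(khatri_rao ts Z W *\<^sub>v vec_of_list (block_coeffs ts Y)) $ x
    = (\<Sum>y<length (concat (map g [0..<length ts])).
        h (concat (map f [0..<length ts]) ! y) (concat (map g [0..<length ts]) ! y))"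
    unfolding khatri_rao_def block_coeffs_def f_def[symmetric] g_def[symmetric] h_def
    using x Z W lenc[of "[0..<length ts]"]
    by (auto simp: scalar_prod_def atLeast0LessThan mat_of_cols_def vec_of_list_index intro!: sum.cong)
  also have "\<dots> = sum_list (map2 h (concat (map f [0..<length ts])) (concat (map g [0..<length ts])))"
    by (simp add: sum_list_sum_nth lenc atLeast0LessThan)
  also have "\<dots> = (\<Sum>j\<leftarrow>[0..<length ts]. sum_list (map2 h (f j) (g j)))"
  proof -
    have "sum_list (map2 h (concat (map f js)) (concat (map g js))) = (\<Sum>j\<leftarrow>js. sum_list (map2 h (f j) (g j)))" for js
      by (induction js) (simp_all add: len)
    thus ?thesis .
  qed
  also have "\<dots> = (\<Sum>j<length ts. sum_list (map2 h (f j) (g j)))"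
    by (simp add: interv_sum_list_conv_sum_set_nat atLeast0LessThan)
  also have "\<dots> = (\<Sum>j<length ts. \<Sum>l<ts ! j. \<Sum>k<ts ! j.
       Z $$ (x div n, block_offset ts j + l) * W $$ (x mod n, block_offset ts j + k)
       * Y $$ (block_offset ts j + k, block_offset ts j + l))"
  proof (rule sum.cong[OF refl])
    fix j
    let ?t = "ts ! j" and ?o = "block_offset ts j"
    have "0 < n" using x by (cases n) auto
    hence n: "x mod n < n" "x div n < m" using x by (simp_all add: less_mult_imp_div_less)
    have "sum_list (map2 h (f j) (g j)) = (\<Sum>c<?t * ?t. h (f j ! c) (g j ! c))"
      by (simp add: sum_list_sum_nth len[unfolded g_def] g_def atLeast0LessThan)
    also have "\<dots> = (\<Sum>c<?t * ?t. Z $$ (x div n, ?o + c div ?t) * W $$ (x mod n, ?o + c mod ?t)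
        * Y $$ (?o + c mod ?t, ?o + c div ?t))"
    proof (rule sum.cong[OF refl])
      fix c assume "c \<in> {..<?t * ?t}"
      hence c: "c < ?t * ?t" by simp
      hence "0 < ?t" by (cases "?t") auto
      hence "c mod ?t < ?t" "c div ?t < ?t" using c by (simp_all add: less_mult_imp_div_less)
      with c show "h (f j ! c) (g j ! c) = Z $$ (x div n, ?o + c div ?t) * W $$ (x mod n, ?o + c mod ?t)
        * Y $$ (?o + c mod ?t, ?o + c div ?t)"
        using Z W n x by (simp add: h_def f_def g_def kronecker_def col_block_def)
    qed
    also have "\<dots> = (\<Sum>l<?t. \<Sum>k<?t. Z $$ (x div n, ?o + l) * W $$ (x mod n, ?o + k) * Y $$ (?o + k, ?o + l))"
      \<comment> \<open>The columns of the Kronecker product form \<open>t\<^sub>j\<close> consecutive groups of length \<open>t\<^sub>j\<close>.\<close>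
      using sum_over_blocks[of "\<lambda>c. Z $$ (x div n, ?o + c div ?t) * W $$ (x mod n, ?o + c mod ?t)
        * Y $$ (?o + c mod ?t, ?o + c div ?t)" "replicate ?t ?t"]
      by (auto simp: sum_list_replicate min_def intro!: sum.cong)
    finally show "sum_list (map2 h (f j) (g j)) =
      (\<Sum>l<?t. \<Sum>k<?t. Z $$ (x div n, ?o + l) * W $$ (x mod n, ?o + k) * Y $$ (?o + k, ?o + l))" .
  qed
  finally show ?thesis .
qed

lemma khatri_rao_carrier:
  assumes "Z \<in> carrier_mat m N" "W \<in> carrier_mat n N"
  shows "khatri_rao ts Z W \<in> carrier_mat (m * n) (\<Sum>j<length ts. (ts ! j)\<^sup>2)"
proof (rule carrier_matI)
  have "length (concat (map (\<lambda>j. cols (kronecker (col_block ts Z j) (col_block ts W j))) [0..<length ts]))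
    = (\<Sum>j<length ts. (ts ! j)\<^sup>2)"
    by (simp add: length_concat o_def kronecker_def col_block_def
      interv_sum_list_conv_sum_set_nat power2_eq_square atLeast0LessThan)
  thus "dim_col (khatri_rao ts Z W) = (\<Sum>j<length ts. (ts ! j)\<^sup>2)"
    by (simp add: khatri_rao_def)
qed (use assms in \<open>simp add: khatri_rao_def\<close>)

text \<open>
For block diagonal \<open>Y\<close> the double sum in \<open>W Y Z\<^sup>T\<close> only involves column pairs within the same
block, which are exactly the columns of the Khatri-Rao product. So the entries of \<open>Y\<close> are the
coefficients of a linear relation between them.
\<close>

lemma block_diagonal_relation_imp_khatri_rao_rank_deficient:
  fixes Y Z W :: "'a::field mat"
  assumes Z: "Z \<in> carrier_mat m (sum_list ts)" and W: "W \<in> carrier_mat n (sum_list ts)"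
    and Y: "Y \<in> carrier_mat (sum_list ts) (sum_list ts)" "Y \<noteq> 0\<^sub>m (sum_list ts) (sum_list ts)"
    and diag: "\<And>i j k l. i < length ts \<Longrightarrow> j < length ts \<Longrightarrow> i \<noteq> j \<Longrightarrow> k < ts ! i \<Longrightarrow> l < ts ! j \<Longrightarrow>
      Y $$ (block_offset ts i + k, block_offset ts j + l) = 0"
    and WYZ: "W * Y * Z\<^sup>T = 0\<^sub>m n m"
  shows "mat_rank (khatri_rao ts Z W) < (\<Sum>j<length ts. (ts ! j)\<^sup>2)"
proof -
  let ?o = "block_offset ts"
  let ?v = "vec_of_list (block_coeffs ts Y)"
  have K: "khatri_rao ts Z W \<in> carrier_mat (m * n) (\<Sum>j<length ts. (ts ! j)\<^sup>2)"
    by (rule khatri_rao_carrier[OF Z W])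
  have v: "?v \<in> carrier_vec (\<Sum>j<length ts. (ts ! j)\<^sup>2)"
    by (intro carrier_vecI) (simp add: length_block_coeffs)
  have v_nonzero: "?v \<noteq> 0\<^sub>v (\<Sum>j<length ts. (ts ! j)\<^sup>2)"
  proof
    assume v0: "?v = 0\<^sub>v (\<Sum>j<length ts. (ts ! j)\<^sup>2)"
    have z: "y = 0" if "y \<in> set (block_coeffs ts Y)" for y
    proof -
      from that obtain c where "c < length (block_coeffs ts Y)" "y = block_coeffs ts Y ! c"
        by (auto simp: in_set_conv_nth)
      thus ?thesis using arg_cong[OF v0, of "\<lambda>v. v $ c"] by (simp add: length_block_coeffs vec_of_list_index)
    qed
    have "Y = 0\<^sub>m (sum_list ts) (sum_list ts)"
    proof (rule eq_matI)
      fix a b assume "a < dim_row (0\<^sub>m (sum_list ts) (sum_list ts) :: 'a mat)" "b < dim_col (0\<^sub>m (sum_list ts) (sum_list ts) :: 'a mat)"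
      hence ab: "a < sum_list ts" "b < sum_list ts" by auto
      from block_index_exhaust[OF ab(1)] obtain i k where
        i: "i < length ts" "k < ts ! i" "a = ?o i + k" by blast
      from block_index_exhaust[OF ab(2)] obtain j l where
        j: "j < length ts" "l < ts ! j" "b = ?o j + l" by blast
      have "Y $$ (a, b) = 0"
      proof (cases "i = j")
        case True
        let ?c = "l * ts ! j + k"
        have "?c < Suc l * ts ! j" using i True by simp
        also have "\<dots> \<le> ts ! j * ts ! j" using j by (intro mult_le_mono1) simp
        finally have c: "?c < ts ! j * ts ! j" .
        have "Y $$ (a, b) = Y $$ (?o j + ?c mod ts ! j, ?o j + ?c div ts ! j)"
          using i(2,3) j(3) unfolding True by simp
        also have "\<dots> \<in> set (block_coeffs ts Y)"
          unfolding set_block_coeffs using j(1) c by blast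
        finally show ?thesis by (rule z)
      qed (use diag i j in simp)
      thus "Y $$ (a, b) = 0\<^sub>m (sum_list ts) (sum_list ts) $$ (a, b)" using ab by simp
    qed (use Y in auto)
    with Y show False by simp
  qed
  have "khatri_rao ts Z W *\<^sub>v ?v = 0\<^sub>v (m * n)"
  proof (rule eq_vecI)
    fix x assume "x < dim_vec (0\<^sub>v (m * n) :: 'a vec)"
    hence x: "x < m * n" by simp
    hence "0 < n" by (cases n) auto
    hence n: "x mod n < n" "x div n < m" using x by (simp_all add: less_mult_imp_div_less)
    have Zt: "Z\<^sup>T \<in> carrier_mat (sum_list ts) m" using Z by simp
    have "0 = (W * Y * Z\<^sup>T) $$ (x mod n, x div n)" unfolding WYZ using n by simp
    also have "\<dots> = (\<Sum>b<sum_list ts. (\<Sum>a<sum_list ts. W $$ (x mod n, a) * Y $$ (a, b)) * Z $$ (x div n, b))"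
      using n Z by (simp add: mat_mult_entry[OF mult_carrier_mat[OF W Y(1)] Zt] mat_mult_entry[OF W Y(1)])
    also have "\<dots> = (\<Sum>j<length ts. \<Sum>l<ts ! j. (\<Sum>i<length ts. \<Sum>k<ts ! i.
        W $$ (x mod n, ?o i + k) * Y $$ (?o i + k, ?o j + l)) * Z $$ (x div n, ?o j + l))"
      by (simp add: sum_over_blocks)
    also have "\<dots> = (\<Sum>j<length ts. \<Sum>l<ts ! j. (\<Sum>i<length ts. if j = i then \<Sum>k<ts ! j.
        W $$ (x mod n, ?o j + k) * Y $$ (?o j + k, ?o j + l) else 0) * Z $$ (x div n, ?o j + l))"
      by (intro sum.cong refl arg_cong2[where f = "(*)"]) (auto simp: diag)
    also have "\<dots> = (khatri_rao ts Z W *\<^sub>v ?v) $ x"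
      unfolding khatri_rao_mult_block_coeffs[OF Z W x]
      by (intro sum.cong refl) (simp add: sum_distrib_left sum_distrib_right mult_ac)
    finally show "(khatri_rao ts Z W *\<^sub>v ?v) $ x = 0\<^sub>v (m * n) $ x" using x by simp
  qed (use K in auto)
  from rank_less_if_kernel_nontrivial[OF K v v_nonzero this] show ?thesis .
qed

section \<open>Rank deficiency for symmetrizable systems\<close>

lemma system_matrix_symmetrizer:
  fixes A B C D T S :: "real mat"
  assumes c: "A \<in> carrier_mat n n" "B \<in> carrier_mat n m" "C \<in> carrier_mat m n" "D \<in> carrier_mat m m"
    and TS: "T \<in> carrier_mat n n" "S \<in> carrier_mat m m"
    and eq: "A * T = T * A\<^sup>T" "B * S = T * C\<^sup>T" "C * T = S * B\<^sup>T" "D * S = S * D\<^sup>T"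
  shows "four_block_mat A B C D * four_block_mat T (0\<^sub>m n m) (0\<^sub>m m n) S =
    four_block_mat T (0\<^sub>m n m) (0\<^sub>m m n) S * (four_block_mat A B C D)\<^sup>T"
proof -
  have "four_block_mat A B C D * four_block_mat T (0\<^sub>m n m) (0\<^sub>m m n) S =
      four_block_mat (A * T) (B * S) (C * T) (D * S)"
    using c TS by (subst mult_four_block_mat[of _ n n _ m _ m _ _ n _ m]) auto
  moreover have "four_block_mat T (0\<^sub>m n m) (0\<^sub>m m n) S * (four_block_mat A B C D)\<^sup>T =
      four_block_mat (T * A\<^sup>T) (T * C\<^sup>T) (S * B\<^sup>T) (S * D\<^sup>T)"
    unfolding transpose_four_block_mat[OF c]
    using c TS by (subst mult_four_block_mat[of _ n n _ m _ m _ _ n _ m]) auto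
  ultimately show ?thesis by (simp add: eq)
qed

text \<open>
With \<open>V'\<close> the inverse of \<open>V\<close>: solutions \<open>X\<close> of \<open>P X = X P\<^sup>T\<close> transform by congruence when \<open>P\<close>
transforms by similarity.
\<close>

lemma congruence_symmetrizer:
  fixes P X V V' :: "'a::field mat"
  assumes c: "P \<in> carrier_mat N N" "X \<in> carrier_mat N N" "V \<in> carrier_mat N N" "V' \<in> carrier_mat N N"
    and inv: "V * V' = 1\<^sub>m N" "V' * V = 1\<^sub>m N"
    and PX: "P * X = X * P\<^sup>T"
  shows "(V' * P * V) * (V' * X * V'\<^sup>T) = (V' * X * V'\<^sup>T) * (V' * P * V)\<^sup>T"
    and "V * (V' * X * V'\<^sup>T) * V\<^sup>T = X"
proof -
  note as = assoc_mult_mat[of _ N N _ N _ N]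
  have cancel: "V * (V' * M) = M" if "M \<in> carrier_mat N N" for M
    using that c inv by (simp add: as[symmetric])
  have invt: "V'\<^sup>T * V\<^sup>T = 1\<^sub>m N" using inv c by (simp add: transpose_mult[symmetric])
  have cancelt: "V'\<^sup>T * (V\<^sup>T * M) = M" if "M \<in> carrier_mat N N" for M
    using that c invt by (simp add: as[symmetric])
  have "(V' * P * V) * (V' * X * V'\<^sup>T) = V' * (P * X * V'\<^sup>T)"
    using c by (simp add: as cancel)
  also have "\<dots> = (V' * X * V'\<^sup>T) * (V' * P * V)\<^sup>T"
    unfolding PX using c by (simp add: as cancelt transpose_mult[of _ N N _ N])
  finally show "(V' * P * V) * (V' * X * V'\<^sup>T) = (V' * X * V'\<^sup>T) * (V' * P * V)\<^sup>T" .
  show "V * (V' * X * V'\<^sup>T) * V\<^sup>T = X"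
    using c by (simp add: as cancel invt)
qed

theorem theorem2:
  fixes n m p q :: nat
    and A B C D P V W Z :: "real mat"
    and ls :: "complex list"
    and ts :: "nat list"
  assumes "0 < m"
    and "A \<in> carrier_mat n n" and "B \<in> carrier_mat n m"
    and "C \<in> carrier_mat m n" and "D \<in> carrier_mat m m"
    and "minimal_system A B C"
    and "P = four_block_mat A B C D"
    and "eigenvalue_listing P p q ls"
    and "ts = map (block_size P) ls"
    and "real_jordan_normal_form P ls V"
    and "W \<in> carrier_mat n (n + m)" and "Z \<in> carrier_mat m (n + m)"
    and "V = W @\<^sub>r Z"
    and "symmetrizable A B C D"
  shows "mat_rank (khatri_rao ts Z W) < (\<Sum>j<p + q. (ts ! j)\<^sup>2)"
proof -
  note sys = assms(2-5)
  let ?N = "n + m"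
  obtain S where S: "S \<in> carrier_mat m m" "S \<noteq> 0\<^sub>m m m"
    and sym: "\<And>s. s \<notin> spectrum (cmat A) \<Longrightarrow>
      cmat S * (transfer_function A B C D s)\<^sup>T = transfer_function A B C D s * cmat S"
    using symmetrizable_imp_symmetrizer[OF sys assms(1,14)] by blast
  note markov = symmetrizer_markov[OF sys S(1) sym]
  obtain T where T: "T \<in> carrier_mat n n" "A * T = T * A\<^sup>T" "B * S = T * C\<^sup>T" "C * T = S * B\<^sup>T"
    using observable_symmetrizer_extends[OF sys(1-3) S(1) _ markov(2)] assms(6)
    unfolding minimal_system_def by blast
  define X where "X = four_block_mat T (0\<^sub>m n m) (0\<^sub>m m n) S"
  have X: "X \<in> carrier_mat ?N ?N" unfolding X_def using T S by auto
  have PX: "P * X = X * P\<^sup>T"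
    unfolding X_def assms(7)
    by (rule system_matrix_symmetrizer[OF sys T(1) S(1) T(2-4) markov(1)[symmetric]])
  have P: "P \<in> carrier_mat ?N ?N" unfolding assms(7) using sys by auto
  have V: "V \<in> carrier_mat ?N ?N" "invertible_mat V"
    using assms(10) carrier_matD[OF P] unfolding real_jordan_normal_form_def by auto
  obtain Js where Js_all: "length Js = length ls"
      "\<forall>j<length ls. Js ! j \<in> carrier_mat (block_size P (ls ! j)) (block_size P (ls ! j)) \<and>
        (\<exists>ks. 0 \<notin> set ks \<and> Js ! j = diag_block_mat (map (real_jordan_block (ls ! j)) ks))"
      and J: "mat_inv V * P * V = diag_block_mat Js"
    using assms(10) unfolding real_jordan_normal_form_def by blast
  have Js: "length Js = length ls"
      "\<And>j. j < length ls \<Longrightarrow> Js ! j \<in> carrier_mat (ts ! j) (ts ! j)"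
      "\<And>j. j < length ls \<Longrightarrow> \<exists>ks. Js ! j = diag_block_mat (map (real_jordan_block (ls ! j)) ks)"
    using Js_all unfolding assms(9) by auto
  have len: "length ts = length ls" "length ls = p + q"
    using assms(8,9) by (simp_all add: eigenvalue_listing_def)
  define V' where "V' = mat_inv V"
  note V' = mat_inv_inverse[OF V(1) invertible_mat_det_nonzero[OF V], folded V'_def]
  define Y where "Y = V' * X * V'\<^sup>T"
  have Y: "Y \<in> carrier_mat ?N ?N" unfolding Y_def using V' X by auto
  note cong = congruence_symmetrizer[OF P X V(1) V' PX, folded Y_def]
  \<comment> \<open>The block sizes add up to the order of \<open>P\<close> because the blocks make up a matrix similar to \<open>P\<close>.\<close>
  have N: "sum_list ts = ?N"
  proof -
    have "map dim_row Js = ts"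
      using Js(1) carrier_matD(1)[OF Js(2)] len by (intro nth_equalityI) auto
    moreover have "dim_row (diag_block_mat Js) = ?N" unfolding J[symmetric] V'_def[symmetric] using V' by simp
    ultimately show ?thesis by (simp add: dim_diag_block_mat)
  qed
  have "Y \<noteq> 0\<^sub>m ?N ?N"
  proof
    assume "Y = 0\<^sub>m ?N ?N"
    hence X0: "X = 0\<^sub>m ?N ?N" using cong(2) V by simp
    have "S $$ (i, j) = 0" if "i < m" "j < m" for i j
      using arg_cong[OF X0, of "\<lambda>M. M $$ (n + i, n + j)"] that T(1) S(1) by (simp add: X_def)
    hence "S = 0\<^sub>m m m" using S(1) by (intro eq_matI) auto
    with S(2) show False by simp
  qed
  have WV: "W $$ (i, a) = V $$ (i, a)" if "i < n" "a < ?N" for i a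
    using that assms(11,12) unfolding assms(13) append_rows_def by simp
  have ZV: "Z $$ (j, a) = V $$ (n + j, a)" if "j < m" "a < ?N" for j a
    using that assms(11,12) unfolding assms(13) append_rows_def by simp
  have "W * Y * Z\<^sup>T = 0\<^sub>m n m"
  proof (rule eq_matI)
    fix i j assume "i < dim_row (0\<^sub>m n m :: real mat)" "j < dim_col (0\<^sub>m n m :: real mat)"
    hence ij: "i < n" "j < m" by auto
    have t: "Z\<^sup>T \<in> carrier_mat ?N m" "V\<^sup>T \<in> carrier_mat ?N ?N" using assms(12) V by auto
    have "(W * Y * Z\<^sup>T) $$ (i, j) = (\<Sum>b<?N. (\<Sum>a<?N. W $$ (i, a) * Y $$ (a, b)) * Z $$ (j, b))"
      using ij assms(12)
      by (simp add: mat_mult_entry[OF mult_carrier_mat[OF assms(11) Y] t(1)] mat_mult_entry[OF assms(11) Y])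
    also have "\<dots> = (\<Sum>b<?N. (\<Sum>a<?N. V $$ (i, a) * Y $$ (a, b)) * V $$ (n + j, b))"
      using ij by (simp add: WV ZV)
    also have "\<dots> = (V * Y * V\<^sup>T) $$ (i, n + j)"
    proof -
      have "i < ?N" "n + j < ?N" using ij by auto
      thus ?thesis
        unfolding mat_mult_entry[OF mult_carrier_mat[OF V(1) Y] t(2) \<open>i < ?N\<close> \<open>n + j < ?N\<close>]
        using V(1) by (simp add: mat_mult_entry[OF V(1) Y])
    qed
    also have "\<dots> = 0" unfolding cong(2) X_def using ij T(1) S(1) by simp
    finally show "(W * Y * Z\<^sup>T) $$ (i, j) = 0\<^sub>m n m $$ (i, j)" using ij by simp
  qed (use assms(11,12) in auto)
  moreover have "Y $$ (block_offset ts i + k, block_offset ts j + l) = 0"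
    if "i < length ts" "j < length ts" "i \<noteq> j" "k < ts ! i" "l < ts ! j" for i j k l
  proof (rule symmetrizer_block_diagonal[of Js ts Y i j k l])
    show "spectrum (cmat (Js ! i)) \<inter> spectrum (cmat (Js ! j)) = {}"
      if ij: "i < length ts" "j < length ts" "i \<noteq> j" for i j
    proof -
      obtain ks ks' where "Js ! i = diag_block_mat (map (real_jordan_block (ls ! i)) ks)"
        "Js ! j = diag_block_mat (map (real_jordan_block (ls ! j)) ks')"
        using Js(3)[of i] Js(3)[of j] ij len by auto
      hence "spectrum (cmat (Js ! i)) \<subseteq> {ls ! i, cnj (ls ! i)}"
        "spectrum (cmat (Js ! j)) \<subseteq> {ls ! j, cnj (ls ! j)}"
        using spectrum_real_jordan_blocks by metis+
      moreover have "{ls ! i, cnj (ls ! i)} \<inter> {ls ! j, cnj (ls ! j)} = {}"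
        using assms(8) ij len unfolding eigenvalue_listing_def by metis
      ultimately show ?thesis by blast
    qed
    show "diag_block_mat Js * Y = Y * (diag_block_mat Js)\<^sup>T"
      using cong(1) J unfolding V'_def by simp
  qed (use that Js(1,2) Y N len in simp_all)
  ultimately have "mat_rank (khatri_rao ts Z W) < (\<Sum>j<length ts. (ts ! j)\<^sup>2)"
    using block_diagonal_relation_imp_khatri_rao_rank_deficient[of Z m ts W n Y]
      assms(11,12) Y \<open>Y \<noteq> 0\<^sub>m ?N ?N\<close> unfolding N by blast
  thus ?thesis using len by simp
qed

end
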